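(* Let $G$ be a finite non-empty graph and let $k$ be a non-negative integer. Then $G$ has ab-tree-cut width $\leq k$ if and only if $G$ is $k$-searchable.
   Context: Graphs are finite and undirected; parallel edges are allowed, loops are not. A near-partition of a set $\Omega$ is a family of pairwise disjoint (possibly empty) subsets of $\Omega$ with union $\Omega$. Two vertices $u,v$ of $G$ are 3-edge-connected in $G$ if $u=v$ or there are three pairwise edge-disjoint paths in $G$ connecting $u$ and $v$. ab-tree-cut width. A tree-cut decomposition of $G$ is a pair $\mathcal{T}=(T,\mathcal{X})$ where $T$ is a tree and $\mathcal{X}=\{X_t : t\in V(T)\}$ is a near-partition of $V(G)$ indexed by the nodes of $T$; $X_t$ is the bag of $t$. For an edge $st$ of $T$, $\mathrm{adh}(st)$ is the set of edges $uv$ of $G$ such that the node whose bag contains $u$ and the node whose bag contains $v$ lie in different components of $T-st$. The edge $st$ is bold if $|\mathrm{adh}(st)|\geq 3$ and thin otherwise. For a node $t$, $\mathrm{adh}(t)$ is the union of the sets $\mathrm{adh}(st)$ over all bold edges $st$ of $T$ incident to $t$. The adhesion-width of $\mathcal{T}$ is $\max_{t\in V(T)}|\mathrm{adh}(t)|$ and the bag-width of $\mathcal{T}$ is $\max_{t\in V(T)}|X_t|$. The ab-tree-cut width of $G$ is the least number $k$ such that $G$ has a tree-cut decomposition with adhesion-width $\leq k$ and bag-width $\leq k$. The cops, dogs, and robber game with $p$ cops and $q$ dogs ($p,q\geq 0$ integers) is played on $G$ by two players, the cop player (controlling cops and dogs) and the robber player. The robber player first places the robber at a vertex $r_0$; the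 cops initially occupy the edge set $F_0=\emptyset$. In each round $i=1,2,3,\ldots$: the cop player announces a set $F_i\subseteq E(G)$ with $|F_i|\leq p$; then the robber player, knowing $F_i$, moves the robber from $r_{i-1}$ to a vertex $r_i$ (possibly $r_i=r_{i-1}$) that is reachable from $r_{i-1}$ by a path of $G$ containing no edge of $F_{i-1}\cap F_i$ and that is 3-edge-connected with $r_{i-1}$ in $G$; then the cops move to $F_i$. After each round $i$, if the number of vertices of $G$ that are 3-edge-connected with $r_i$ in $G$ and reachable from $r_i$ by a path avoiding the edges of $F_i$ (including $r_i$ itself) is $\leq q$, the cop player wins immediately. The robber player wins if she avoids being caught indefinitely. $G$ is searchable by $p$ cops and $q$ dogs if the cop player has a strategy to win this game, and $k$-searchable if it is searchable by $k$ cops and $k$ dogs. *)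

theory Defs
  imports Main
begin

record ('v, 'e) mgraph =
  verts :: "'v set"
  edges :: "'e set"
  ends  :: "'e \<Rightarrow> 'v set"

definition multigraph :: "('v, 'e) mgraph \<Rightarrow> bool" where
  "multigraph G \<longleftrightarrow> finite (verts G) \<and> finite (edges G) \<and>
     (\<forall>e\<in>edges G. ends G e \<subseteq> verts G \<and> card (ends G e) = 2)"

text \<open>A path is given by its vertex sequence together with its edge sequence, because parallel
  edges are allowed. The one-vertex path is included.\<close>

definition path_between ::
  "('v, 'e) mgraph \<Rightarrow> 'v \<Rightarrow> 'v list \<Rightarrow> 'e list \<Rightarrow> 'v \<Rightarrow> bool" where
  "path_between G u vs es v \<longleftrightarrow>
     length vs = Suc (length es) \<and> hd vs = u \<and> last vs = v \<and>
     set vs \<subseteq> verts G \<and> set es \<subseteq> edges G \<and> distinct vs \<and>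
     (\<forall>i<length es. ends G (es ! i) = {vs ! i, vs ! Suc i})"

definition reachable_avoiding :: "('v, 'e) mgraph \<Rightarrow> 'e set \<Rightarrow> 'v \<Rightarrow> 'v \<Rightarrow> bool" where
  "reachable_avoiding G F u v \<longleftrightarrow>
     (\<exists>vs es. path_between G u vs es v \<and> set es \<inter> F = {})"

definition three_edge_connected :: "('v, 'e) mgraph \<Rightarrow> 'v \<Rightarrow> 'v \<Rightarrow> bool" where
  "three_edge_connected G u v \<longleftrightarrow>
     u = v \<or>
     (\<exists>vs1 es1 vs2 es2 vs3 es3.
        path_between G u vs1 es1 v \<and> path_between G u vs2 es2 v \<and> path_between G u vs3 es3 v \<and>
        set es1 \<inter> set es2 = {} \<and> set es1 \<inter> set es3 = {} \<and> set es2 \<inter> set es3 = {})"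

text \<open>The case \<open>length vs = 2\<close> of a cycle is a pair of parallel edges.\<close>

definition is_cycle :: "('v, 'e) mgraph \<Rightarrow> 'v list \<Rightarrow> 'e list \<Rightarrow> bool" where
  "is_cycle G vs es \<longleftrightarrow>
     length vs = length es \<and> 2 \<le> length vs \<and>
     set vs \<subseteq> verts G \<and> set es \<subseteq> edges G \<and> distinct vs \<and> distinct es \<and>
     (\<forall>i<length es. ends G (es ! i) = {vs ! i, vs ! (Suc i mod length vs)})"

definition is_tree :: "('v, 'e) mgraph \<Rightarrow> bool" where
  "is_tree T \<longleftrightarrow> multigraph T \<and> verts T \<noteq> {} \<and>
     (\<forall>s\<in>verts T. \<forall>t\<in>verts T. reachable_avoiding T {} s t) \<and>
     (\<nexists>vs es. is_cycle T vs es)"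

definition near_partition :: "'i set \<Rightarrow> ('i \<Rightarrow> 'a set) \<Rightarrow> 'a set \<Rightarrow> bool" where
  "near_partition I X \<Omega> \<longleftrightarrow>
     (\<forall>i\<in>I. \<forall>j\<in>I. i \<noteq> j \<longrightarrow> X i \<inter> X j = {}) \<and> (\<Union>i\<in>I. X i) = \<Omega>"

definition tree_cut_decomposition ::
  "('v, 'e) mgraph \<Rightarrow> ('n, 'm) mgraph \<Rightarrow> ('n \<Rightarrow> 'v set) \<Rightarrow> bool" where
  "tree_cut_decomposition G T X \<longleftrightarrow> is_tree T \<and> near_partition (verts T) X (verts G)"

text \<open>Nodes \<open>s\<close> and \<open>t\<close> lie in different components of \<open>T - a\<close> iff no path of \<open>T\<close> avoiding
  the edge \<open>a\<close> joins them.\<close>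

definition edge_adh ::
  "('v, 'e) mgraph \<Rightarrow> ('n, 'm) mgraph \<Rightarrow> ('n \<Rightarrow> 'v set) \<Rightarrow> 'm \<Rightarrow> 'e set" where
  "edge_adh G T X a =
     {e \<in> edges G. \<exists>u v. \<exists>s\<in>verts T. \<exists>t\<in>verts T.
        ends G e = {u, v} \<and> u \<in> X s \<and> v \<in> X t \<and> \<not> reachable_avoiding T {a} s t}"

definition bold ::
  "('v, 'e) mgraph \<Rightarrow> ('n, 'm) mgraph \<Rightarrow> ('n \<Rightarrow> 'v set) \<Rightarrow> 'm \<Rightarrow> bool" where
  "bold G T X a \<longleftrightarrow> 3 \<le> card (edge_adh G T X a)"

definition node_adh ::
  "('v, 'e) mgraph \<Rightarrow> ('n, 'm) mgraph \<Rightarrow> ('n \<Rightarrow> 'v set) \<Rightarrow> 'n \<Rightarrow> 'e set" where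
  "node_adh G T X t = (\<Union>a\<in>{a \<in> edges T. t \<in> ends T a \<and> bold G T X a}. edge_adh G T X a)"

definition adhesion_width ::
  "('v, 'e) mgraph \<Rightarrow> ('n, 'm) mgraph \<Rightarrow> ('n \<Rightarrow> 'v set) \<Rightarrow> nat" where
  "adhesion_width G T X = Max ((\<lambda>t. card (node_adh G T X t)) ` verts T)"

definition bag_width :: "('n, 'm) mgraph \<Rightarrow> ('n \<Rightarrow> 'v set) \<Rightarrow> nat" where
  "bag_width T X = Max ((\<lambda>t. card (X t)) ` verts T)"

text \<open>Every finite tree is isomorphic to one whose nodes and edges are natural numbers, so
  quantifying over trees of this type loses nothing. The set of admissible \<open>k\<close> is never empty:
  put all vertices into the bag of a one-node tree.\<close>

definition ab_tree_cut_width :: "('v, 'e) mgraph \<Rightarrow> nat" where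
  "ab_tree_cut_width G =
     (LEAST k. \<exists>(T :: (nat, nat) mgraph) X. tree_cut_decomposition G T X \<and>
        adhesion_width G T X \<le> k \<and> bag_width T X \<le> k)"

text \<open>A cop strategy maps the list \<open>[r 0, ..., r (i - 1)]\<close> of robber positions so far to the
  announced edge set of round \<open>i\<close>; the earlier cop positions are determined by it.\<close>

type_synonym ('v, 'e) cop_strategy = "'v list \<Rightarrow> 'e set"

definition valid_cop_strategy ::
  "('v, 'e) mgraph \<Rightarrow> nat \<Rightarrow> ('v, 'e) cop_strategy \<Rightarrow> bool" where
  "valid_cop_strategy G p \<sigma> \<longleftrightarrow> (\<forall>h. \<sigma> h \<subseteq> edges G \<and> card (\<sigma> h) \<le> p)"

definition cop_position :: "('v, 'e) cop_strategy \<Rightarrow> (nat \<Rightarrow> 'v) \<Rightarrow> nat \<Rightarrow> 'e set" where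
  "cop_position \<sigma> r i = (if i = 0 then {} else \<sigma> (map r [0..<i]))"

definition robber_move ::
  "('v, 'e) mgraph \<Rightarrow> 'e set \<Rightarrow> 'e set \<Rightarrow> 'v \<Rightarrow> 'v \<Rightarrow> bool" where
  "robber_move G F F' x y \<longleftrightarrow>
     y \<in> verts G \<and> reachable_avoiding G (F \<inter> F') x y \<and> three_edge_connected G x y"

text \<open>Robber plays are infinite sequences. This is harmless: staying put is always legal, and
  positions after the capture are irrelevant to the winning condition.\<close>

definition robber_play ::
  "('v, 'e) mgraph \<Rightarrow> ('v, 'e) cop_strategy \<Rightarrow> (nat \<Rightarrow> 'v) \<Rightarrow> bool" where
  "robber_play G \<sigma> r \<longleftrightarrow> r 0 \<in> verts G \<and>
     (\<forall>i. robber_move G (cop_position \<sigma> r i) (cop_position \<sigma> r (Suc i)) (r i) (r (Suc i)))"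

definition caught :: "('v, 'e) mgraph \<Rightarrow> nat \<Rightarrow> 'e set \<Rightarrow> 'v \<Rightarrow> bool" where
  "caught G q F x \<longleftrightarrow>
     card {y \<in> verts G. three_edge_connected G x y \<and> reachable_avoiding G F x y} \<le> q"

definition searchable :: "('v, 'e) mgraph \<Rightarrow> nat \<Rightarrow> nat \<Rightarrow> bool" where
  "searchable G p q \<longleftrightarrow>
     (\<exists>\<sigma>. valid_cop_strategy G p \<sigma> \<and>
        (\<forall>r. robber_play G \<sigma> r \<longrightarrow> (\<exists>i\<ge>1. caught G q (cop_position \<sigma> r i) (r i))))"

definition k_searchable :: "('v, 'e) mgraph \<Rightarrow> nat \<Rightarrow> bool" where
  "k_searchable G k \<longleftrightarrow> searchable G k k"

end

theory Submission imports Defs "HOL-Library.Nat_Bijection" begin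

text \<open>
  Given a decomposition, the cops occupy \<open>node_adh t\<close> and move \<open>t\<close> along the tree edge towards the
  robber. She cannot cross back over that edge: if it is bold, its adhesion stays occupied, and if it
  is thin, its two sides are not 3-edge-connected. So the side of the tree she lives in keeps shrinking.

  Conversely, let \<open>N\<close> be a maximal down-closed family of vertex sets such that no decomposition,
  allowed to end in unfinished leaves belonging to \<open>N\<close>, exists. Two sets outside \<open>N\<close> intersect:
  otherwise take minimal disjoint \<open>A\<close> and \<open>B\<close> and partial decompositions whose only leaf outside \<open>N\<close> is
  \<open>A\<close> and \<open>B\<close>, respectively; uncrossing both with a minimum cut between \<open>A\<close> and \<open>B\<close> and gluing them
  along it gives a forbidden decomposition. The sets outside \<open>N\<close> thus form a bramble, which selects
  one 3-edge-connected class and, for every cop position, a large connected part of this class; any two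
  of these parts intersect, so the robber can move from one to the next forever.
\<close>

text \<open>The threshold 3 serves both directions of the duality. A cut of at most two edges adds
  nothing to \<open>node_adh\<close> and never separates 3-edge-connected vertices, so the
  components of \<open>V - cls u\<close> can be split off at no cost
  (\<open>component_thin\<close>). This is why every cop position leaves a part with more than
  \<open>k\<close> vertices of the class: \<open>k\<close> or fewer of them would form a bag whose
  remaining branches are thin or already paid for.

  Two obstacles shape the proof. The width of a node is the size of a union of cuts, so uncrossing
  the cuts one at a time is not enough; the whole union has to be compared at once
  (\<open>bold_cuts_uncross\<close>). Moreover, deleting \<open>F\<close> splits only the class,
  whereas the bramble speaks about partitions of \<open>V\<close>. The other vertices have to be
  distributed over the parts so that the resulting cuts use at most \<open>card F\<close> edges
  altogether, and so that parts for different \<open>F\<close> meet whenever their extensions do.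
  The map \<open>retract u\<close>, chosen independently of \<open>F\<close>, achieves both.\<close>

section \<open>Reachability as a transitive closure\<close>

definition adj :: "('v, 'e) mgraph \<Rightarrow> 'e set \<Rightarrow> ('v \<times> 'v) set" where
  "adj G F = {(x, y). \<exists>e\<in>edges G - F. ends G e = {x, y}}"

lemma path_between_Cons:
  assumes "path_between G y vs es z" "e \<in> edges G" "ends G e = {x, y}" "x \<in> verts G" "x \<notin> set vs"
  shows "path_between G x (x # vs) (e # es) z"
  using assms unfolding path_between_def
  by (cases vs) (auto simp: nth_Cons split: nat.splits)

lemma path_between_drop:
  assumes "path_between G y vs es z" "i < length vs"
  shows "path_between G (vs ! i) (drop i vs) (drop i es) z"
  using assms unfolding path_between_def
  by (auto simp: hd_drop_conv_nth dest: in_set_dropD)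

lemma rtrancl_adj_imp_path:
  assumes "multigraph G" "(x, y) \<in> (adj G F)\<^sup>*" "y \<in> verts G"
  shows "\<exists>vs es. path_between G x vs es y \<and> set es \<inter> F = {}"
  using assms(2)
proof (induction rule: converse_rtrancl_induct)
  case base
  have "path_between G y [y] [] y" using assms(3) by (simp add: path_between_def)
  then show ?case by fastforce
next
  case (step x x')
  then obtain e vs es where e: "e \<in> edges G - F" "ends G e = {x, x'}"
    and p: "path_between G x' vs es y" "set es \<inter> F = {}"
    unfolding adj_def by blast
  show ?case
  proof (cases "x \<in> set vs")
    case True
    then obtain i where i: "i < length vs" "vs ! i = x" by (auto simp: in_set_conv_nth)
    then show ?thesis using path_between_drop[OF p(1) i(1)] p(2) by (metis disjoint_iff in_set_dropD)
  next
    case False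
    moreover have "x \<in> verts G" using e assms(1) unfolding multigraph_def by blast
    ultimately have "path_between G x (x # vs) (e # es) y"
      using path_between_Cons[OF p(1)] e by auto
    then show ?thesis using p(2) e(1) by (metis DiffD2 disjoint_insert(1) inf_commute list.simps(15))
  qed
qed

lemma path_imp_rtrancl_adj:
  assumes "path_between G x vs es y" "set es \<inter> F = {}"
  shows "(x, y) \<in> (adj G F)\<^sup>*"
proof -
  have ne: "vs \<noteq> []" using assms(1) by (auto simp: path_between_def)
  have "i < length vs \<Longrightarrow> (x, vs ! i) \<in> (adj G F)\<^sup>*" for i
  proof (induction i)
    case 0
    then show ?case using assms(1) ne by (simp add: path_between_def hd_conv_nth)
  next
    case (Suc i)
    then have "i < length es" using assms(1) by (simp add: path_between_def)
    then have "es ! i \<in> edges G - F" "ends G (es ! i) = {vs ! i, vs ! Suc i}"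
      using assms unfolding path_between_def by (auto dest: nth_mem)
    then have "(vs ! i, vs ! Suc i) \<in> adj G F" unfolding adj_def by blast
    then show ?case using Suc by (meson Suc_lessD rtrancl.rtrancl_into_rtrancl)
  qed
  from this[of "length vs - 1"] show ?thesis
    using assms(1) ne by (auto simp: path_between_def last_conv_nth)
qed

lemma path_between_ends_in_verts:
  "path_between G x vs es y \<Longrightarrow> x \<in> verts G \<and> y \<in> verts G"
  unfolding path_between_def
  by (metis hd_in_set last_in_set length_0_conv nat.distinct(1) subsetD)

text \<open>Nothing has to be demanded of \<open>x\<close>: it equals \<open>y\<close> or is an end
  of an edge.\<close>

lemma reachable_iff:
  assumes "multigraph G"
  shows "reachable_avoiding G F x y \<longleftrightarrow> y \<in> verts G \<and> (x, y) \<in> (adj G F)\<^sup>*"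
  unfolding reachable_avoiding_def
  using rtrancl_adj_imp_path[OF assms] path_imp_rtrancl_adj path_between_ends_in_verts by metis

lemma adj_sym: "(x, y) \<in> adj G F \<Longrightarrow> (y, x) \<in> adj G F"
  unfolding adj_def by (auto simp: insert_commute)

lemma adj_rtrancl_sym: "(x, y) \<in> (adj G F)\<^sup>* \<Longrightarrow> (y, x) \<in> (adj G F)\<^sup>*"
  by (metis adj_sym symI sym_rtrancl symD)

lemma adj_mono: "F \<subseteq> F' \<Longrightarrow> adj G F' \<subseteq> adj G F"
  unfolding adj_def by blast

lemma rtrancl_adj_closed:
  assumes "(x, y) \<in> (adj G F)\<^sup>*" "x \<in> Z"
    and "\<And>e p q. e \<in> edges G - F \<Longrightarrow> ends G e = {p, q} \<Longrightarrow> p \<in> Z \<Longrightarrow> q \<in> Z"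
  shows "y \<in> Z"
  using assms(1,2)
  by (induction rule: rtrancl_induct) (auto simp: adj_def intro: assms(3))

text \<open>Distinctness is what the flow arguments need: changing the flow on the first arc then
  leaves the later arcs of the walk usable.\<close>

lemma rtrancl_imp_distinct_walk:
  assumes "(x, y) \<in> R\<^sup>*"
  shows "\<exists>vs. distinct (x # vs) \<and> last (x # vs) = y \<and> successively (\<lambda>a b. (a, b) \<in> R) (x # vs)"
  using assms
proof (induction rule: converse_rtrancl_induct)
  case base
  then show ?case by (intro exI[of _ "[]"]) auto
next
  case (step x x')
  then obtain vs where vs: "distinct (x' # vs)" "last (x' # vs) = y"
    "successively (\<lambda>a b. (a, b) \<in> R) (x' # vs)" by blast
  show ?case
  proof (cases "x \<in> set (x' # vs)")
    case True
    then obtain as bs where s: "x' # vs = as @ x # bs" by (meson split_list)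
    show ?thesis using vs unfolding s by (intro exI[of _ bs]) (auto simp: successively_append_iff)
  next
    case False
    then show ?thesis using vs step(1) by (intro exI[of _ "x' # vs"]) auto
  qed
qed

subsection \<open>Cuts\<close>

definition edge_cut :: "('v, 'e) mgraph \<Rightarrow> 'v set \<Rightarrow> 'e set" where
  "edge_cut G Z = {e \<in> edges G. ends G e \<inter> Z \<noteq> {} \<and> ends G e - Z \<noteq> {}}"

lemma cut_subset: "edge_cut G Z \<subseteq> edges G"
  unfolding edge_cut_def by blast

lemma path_meets_cut:
  assumes "path_between G x vs es y" "x \<in> Z \<longleftrightarrow> y \<notin> Z"
  shows "set es \<inter> edge_cut G Z \<noteq> {}"
proof
  assume "set es \<inter> edge_cut G Z = {}"
  then have r: "(x, y) \<in> (adj G (edge_cut G Z))\<^sup>*" using path_imp_rtrancl_adj assms(1) by metis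
  have c: "p \<in> Z \<longleftrightarrow> q \<in> Z" if "e \<in> edges G - edge_cut G Z" "ends G e = {p, q}" for e p q
    using that unfolding edge_cut_def by blast
  show False
    using rtrancl_adj_closed[OF r, of Z] rtrancl_adj_closed[OF r, of "- Z"] c assms(2) by blast
qed

locale fin_graph =
  fixes G :: "('v, 'e) mgraph"
  assumes multigraph: "multigraph G"
begin

abbreviation "V \<equiv> verts G"
abbreviation "E \<equiv> edges G"

lemma finite_V: "finite V" and finite_E: "finite E"
  using multigraph unfolding multigraph_def by auto

lemma ends_subset: "e \<in> E \<Longrightarrow> ends G e \<subseteq> V"
  using multigraph unfolding multigraph_def by auto

lemma ends_pair:
  assumes "e \<in> E"
  obtains x y where "ends G e = {x, y}" "x \<noteq> y" "x \<in> V" "y \<in> V"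
proof -
  have "card (ends G e) = 2" "ends G e \<subseteq> V"
    using multigraph assms unfolding multigraph_def by auto
  then show ?thesis using that by (auto simp: card_2_iff)
qed

lemma ends_other:
  assumes "e \<in> E" "x \<in> ends G e"
  obtains y where "ends G e = {x, y}" "x \<noteq> y" "y \<in> V"
proof -
  obtain a b where "ends G e = {a, b}" "a \<noteq> b" "a \<in> V" "b \<in> V"
    using ends_pair[OF assms(1)] .
  then show ?thesis
    using assms(2) that[of a] that[of b] by (cases "x = a") (simp_all add: insert_commute)
qed

lemma finite_cut: "finite (edge_cut G Z)"
  by (rule finite_subset[OF cut_subset finite_E])

lemma cutE:
  assumes "e \<in> edge_cut G Z"
  obtains x y where "e \<in> E" "ends G e = {x, y}" "x \<in> Z" "y \<notin> Z" "x \<in> V" "y \<in> V"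
proof -
  have e: "e \<in> E" using assms unfolding edge_cut_def by blast
  obtain x where x: "x \<in> ends G e" "x \<in> Z" using assms unfolding edge_cut_def by blast
  obtain y where y: "ends G e = {x, y}" "y \<in> V" using ends_other[OF e x(1)] .
  have "y \<notin> Z" using assms x y(1) unfolding edge_cut_def by auto
  moreover have "x \<in> V" using ends_subset[OF e] x(1) by blast
  ultimately show ?thesis using that e x(2) y by blast
qed

lemma cutI: "e \<in> E \<Longrightarrow> ends G e = {x, y} \<Longrightarrow> x \<in> Z \<Longrightarrow> y \<notin> Z \<Longrightarrow> e \<in> edge_cut G Z"
  unfolding edge_cut_def by blast

lemma cut_pair_iff: "e \<in> E \<Longrightarrow> ends G e = {x, y} \<Longrightarrow> e \<in> edge_cut G Z \<longleftrightarrow> (x \<in> Z) \<noteq> (y \<in> Z)"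
  unfolding edge_cut_def by auto

lemma cut_compl: "edge_cut G (V - Z) = edge_cut G Z"
  unfolding edge_cut_def using ends_subset by blast

lemma cut_empty: "edge_cut G {} = {}" and cut_V: "edge_cut G V = {}"
  unfolding edge_cut_def using ends_subset by auto

subsection \<open>Three edge-disjoint paths across cuts of size at least three\<close>

text \<open>A flow orients some of the edges: \<open>f e = Some x\<close> means that \<open>e\<close> carries one unit away from
  its end \<open>x\<close>.\<close>

definition is_flow :: "('e \<Rightarrow> 'v option) \<Rightarrow> bool" where
  "is_flow f \<longleftrightarrow> (\<forall>e\<in>E. \<forall>x. f e = Some x \<longrightarrow> x \<in> ends G e)"

definition excess :: "('e \<Rightarrow> 'v option) \<Rightarrow> 'e \<Rightarrow> 'v \<Rightarrow> int" where
  "excess f e x = (case f e of None \<Rightarrow> 0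
     | Some t \<Rightarrow> if x = t then 1 else if x \<in> ends G e then -1 else 0)"

definition outflow :: "('e \<Rightarrow> 'v option) \<Rightarrow> 'v \<Rightarrow> int" where
  "outflow f x = (\<Sum>e\<in>E. excess f e x)"

definition flow_arcs :: "('e \<Rightarrow> 'v option) \<Rightarrow> ('v \<times> 'v) set" where
  "flow_arcs f = {(x, y). \<exists>e\<in>E. ends G e = {x, y} \<and> x \<noteq> y \<and> f e = Some x}"

text \<open>The residual graph of an undirected network with unit capacities: an edge can be used
  from \<open>x\<close> if it is idle, or if its unit flows towards \<open>x\<close> and can be
  cancelled. \<open>push\<close> does the one or the other.\<close>

definition residual_arcs :: "('e \<Rightarrow> 'v option) \<Rightarrow> ('v \<times> 'v) set" where
  "residual_arcs f = {(x, y). \<exists>e\<in>E. ends G e = {x, y} \<and> x \<noteq> y \<and> f e \<noteq> Some x}"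

definition push :: "('e \<Rightarrow> 'v option) \<Rightarrow> 'e \<Rightarrow> 'v \<Rightarrow> ('e \<Rightarrow> 'v option)" where
  "push f e x = f(e := if f e = None then Some x else None)"

lemma push_outflow:
  assumes "is_flow f" "e \<in> E" "ends G e = {x, y}" "x \<noteq> y" "f e \<noteq> Some x"
  shows "is_flow (push f e x)"
    and "outflow (push f e x) z = outflow f z + of_bool (z = x) - of_bool (z = y)"
proof -
  show "is_flow (push f e x)" using assms by (auto simp: is_flow_def push_def)
  have fe: "f e = None \<or> f e = Some y" using assms unfolding is_flow_def by (cases "f e") auto
  have "excess (push f e x) e' z = excess f e' z" if "e' \<noteq> e" for e'
    using that by (simp add: excess_def push_def)
  then have "outflow (push f e x) z - outflow f z = excess (push f e x) e z - excess f e z"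
    using finite_E assms(2) unfolding outflow_def
    by (simp add: sum.remove[OF finite_E assms(2)])
  also have "\<dots> = of_bool (z = x) - of_bool (z = y)"
    using fe assms(3,4) by (elim disjE) (simp_all add: excess_def push_def of_bool_def)
  finally show "outflow (push f e x) z = outflow f z + of_bool (z = x) - of_bool (z = y)" by simp
qed

lemma sum_excess:
  assumes "is_flow f" "e \<in> E" "ends G e = {x, y}" "x \<noteq> y" "f e = Some x" "Z \<subseteq> V"
  shows "(\<Sum>z\<in>Z. excess f e z) = of_bool (x \<in> Z) - of_bool (y \<in> Z)"
proof -
  have fin: "finite Z" using assms(6) finite_V finite_subset by blast
  have "(\<Sum>z\<in>Z. excess f e z) = (\<Sum>z\<in>Z. of_bool (z = x) - of_bool (z = y))"
    using assms by (intro sum.cong) (auto simp: excess_def)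
  also have "\<dots> = of_bool (x \<in> Z) - of_bool (y \<in> Z)"
    using fin by (simp add: sum_subtractf of_bool_def)
  finally show ?thesis .
qed

lemma sum_outflow_swap: "(\<Sum>z\<in>Z. outflow f z) = (\<Sum>e\<in>E. \<Sum>z\<in>Z. excess f e z)"
  unfolding outflow_def by (rule sum.swap)

lemma sum_outflow_source:
  assumes "u \<in> Z" "v \<notin> Z" "Z \<subseteq> V" "\<And>z. z \<noteq> u \<Longrightarrow> z \<noteq> v \<Longrightarrow> outflow f z = 0"
  shows "(\<Sum>z\<in>Z. outflow f z) = outflow f u"
proof -
  have fin: "finite Z" using assms(3) finite_V finite_subset by blast
  have "(\<Sum>z\<in>Z - {u}. outflow f z) = 0" using assms by (intro sum.neutral) auto
  then show ?thesis using sum.remove[OF fin assms(1), of "outflow f"] by simp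
qed

text \<open>After a push along the first arc the rest of the walk remains to be treated, and the
  changes of \<open>outflow\<close> telescope.\<close>

lemma augment:
  assumes "is_flow f" "distinct (x # vs)" "last (x # vs) = v"
    "successively (\<lambda>a b. (a, b) \<in> residual_arcs f) (x # vs)"
  shows "\<exists>f'. is_flow f' \<and> (\<forall>z. outflow f' z = outflow f z + of_bool (z = x) - of_bool (z = v))"
  using assms
proof (induction vs arbitrary: f x)
  case Nil
  then show ?case by (intro exI[of _ f]) auto
next
  case (Cons y vs)
  then obtain e where e: "e \<in> E" "ends G e = {x, y}" "x \<noteq> y" "f e \<noteq> Some x"
    unfolding residual_arcs_def by auto
  let ?g = "push f e x"
  have g: "is_flow ?g" "outflow ?g z = outflow f z + of_bool (z = x) - of_bool (z = y)" for z
    using push_outflow[OF Cons.prems(1) e] by auto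
  have "successively (\<lambda>a b. (a, b) \<in> residual_arcs ?g) (y # vs)"
  proof (rule successively_mono)
    show "successively (\<lambda>a b. (a, b) \<in> residual_arcs f) (y # vs)" using Cons.prems(4) by simp
    fix a b assume ab: "a \<in> set (y # vs)" "b \<in> set (y # vs)" "(a, b) \<in> residual_arcs f"
    then obtain e' where e': "e' \<in> E" "ends G e' = {a, b}" "a \<noteq> b" "f e' \<noteq> Some a"
      unfolding residual_arcs_def by auto
    \<comment> \<open>The end \<open>x\<close> of \<open>e\<close> does not recur on the walk, so
      the remaining arcs stay residual.\<close>
    have "e' \<noteq> e" using e' e ab Cons.prems(2) by auto
    then show "(a, b) \<in> residual_arcs ?g" using e' unfolding residual_arcs_def push_def by auto
  qed
  then obtain f' where f': "is_flow f'"
    "\<forall>z. outflow f' z = outflow ?g z + of_bool (z = y) - of_bool (z = v)"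
    using Cons.IH[OF g(1)] Cons.prems by auto
  then show ?case using g(2) by (intro exI[of _ f']) auto
qed

text \<open>Ford-Fulkerson, one unit per induction step. If \<open>v\<close> is not reached in the
  residual graph, every edge leaving the reached set \<open>Z\<close> carries a unit outwards, so
  the value \<open>n\<close> equals the size of a cut that has at least \<open>Suc n\<close>
  edges.\<close>

lemma max_flow:
  assumes "u \<in> V" "v \<in> V" "u \<noteq> v" "\<And>Z. u \<in> Z \<Longrightarrow> v \<notin> Z \<Longrightarrow> n \<le> card (edge_cut G Z)"
  shows "\<exists>f. is_flow f \<and> outflow f u = int n \<and> (\<forall>z. z \<noteq> u \<longrightarrow> z \<noteq> v \<longrightarrow> outflow f z = 0)"
  using assms(4)
proof (induction n)
  case 0
  show ?case by (intro exI[of _ "\<lambda>_. None"]) (auto simp: is_flow_def outflow_def excess_def)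
next
  case (Suc n)
  obtain f where f: "is_flow f" "outflow f u = int n"
    "\<And>z. z \<noteq> u \<Longrightarrow> z \<noteq> v \<Longrightarrow> outflow f z = 0"
    using Suc.IH Suc.prems Suc_leD by metis
  define Z where "Z = {z. (u, z) \<in> (residual_arcs f)\<^sup>*}"
  have res_V: "residual_arcs f \<subseteq> V \<times> V" using ends_subset unfolding residual_arcs_def by blast
  have "(u, z) \<in> (residual_arcs f)\<^sup>* \<Longrightarrow> z \<in> V" for z
    by (induction rule: rtrancl_induct) (use assms(1) res_V in auto)
  then have ZV: "Z \<subseteq> V" unfolding Z_def by blast
  have uZ: "u \<in> Z" by (simp add: Z_def)
  have "v \<in> Z"
  proof (rule ccontr)
    assume v: "v \<notin> Z"
    have "(\<Sum>z\<in>Z. excess f e z) = of_bool (e \<in> edge_cut G Z)" if e: "e \<in> E" for e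
    proof -
      have into: "q \<in> Z" if "p \<in> Z" "ends G e = {p, q}" "p \<noteq> q" "f e \<noteq> Some p" for p q
        using that e unfolding Z_def residual_arcs_def
        by (auto intro: rtrancl.rtrancl_into_rtrancl)
      show ?thesis
      proof (cases "f e")
        case None
        obtain x y where "ends G e = {x, y}" "x \<noteq> y" using ends_pair[OF e] by blast
        then have "e \<notin> edge_cut G Z"
          using into[of x y] into[of y x] None e by (auto simp: cut_pair_iff insert_commute)
        then show ?thesis using None by (simp add: excess_def)
      next
        case (Some x)
        then have "x \<in> ends G e" using f(1) e unfolding is_flow_def by auto
        then obtain y where y: "ends G e = {x, y}" "x \<noteq> y" using ends_other[OF e] by blast
        then have "y \<in> Z \<Longrightarrow> x \<in> Z" using into[of y x] Some by (auto simp: insert_commute)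
        then show ?thesis using sum_excess[OF f(1) e y Some ZV] cut_pair_iff[OF e y(1)] by auto
      qed
    qed
    then have "(\<Sum>z\<in>Z. outflow f z) = (\<Sum>e\<in>E. of_bool (e \<in> edge_cut G Z))"
      unfolding sum_outflow_swap by (intro sum.cong) auto
    also have "\<dots> = int (card (edge_cut G Z))"
      using finite_E cut_subset[of G Z] by (simp add: of_bool_def sum.If_cases Int_absorb1)
    finally have "int n = int (card (edge_cut G Z))"
      using sum_outflow_source[OF uZ v ZV] f by auto
    then show False using Suc.prems[OF uZ v] by simp
  qed
  then have "(u, v) \<in> (residual_arcs f)\<^sup>*" by (simp add: Z_def)
  from rtrancl_imp_distinct_walk[OF this] obtain vs where vs:
    "distinct (u # vs)" "last (u # vs) = v"
    "successively (\<lambda>a b. (a, b) \<in> residual_arcs f) (u # vs)"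
    by blast
  obtain f' where "is_flow f'"
    "\<forall>z. outflow f' z = outflow f z + of_bool (z = u) - of_bool (z = v)"
    using augment[OF f(1) vs] by blast
  then show ?case using f assms(3) by (intro exI[of _ f']) auto
qed

lemma remove_walk:
  assumes "is_flow f" "distinct (x # vs)" "last (x # vs) = v" "x \<in> V"
    "successively (\<lambda>a b. (a, b) \<in> flow_arcs f) (x # vs)"
  shows "\<exists>f' es. is_flow f' \<and> path_between G x (x # vs) es v \<and>
     (\<forall>z. outflow f' z = outflow f z - of_bool (z = x) + of_bool (z = v)) \<and>
     (\<forall>e. f' e \<noteq> None \<longrightarrow> f e \<noteq> None \<and> e \<notin> set es) \<and> (\<forall>e\<in>set es. f e \<noteq> None)"
  using assms
proof (induction vs arbitrary: f x)
  case Nil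
  then show ?case by (intro exI[of _ f] exI[of _ "[]"]) (auto simp: path_between_def)
next
  case (Cons y vs)
  then obtain e where e: "e \<in> E" "ends G e = {x, y}" "x \<noteq> y" "f e = Some x"
    unfolding flow_arcs_def by auto
  let ?g = "push f e y"
  have e': "ends G e = {y, x}" "y \<noteq> x" "f e \<noteq> Some y" using e by auto
  have g: "is_flow ?g" "outflow ?g z = outflow f z + of_bool (z = y) - of_bool (z = x)" for z
    using push_outflow[OF Cons.prems(1) e(1) e'] by auto
  have ge: "?g = f(e := None)" using e(4) by (simp add: push_def)
  have succ: "successively (\<lambda>a b. (a, b) \<in> flow_arcs ?g) (y # vs)"
  proof (rule successively_mono)
    show "successively (\<lambda>a b. (a, b) \<in> flow_arcs f) (y # vs)" using Cons.prems(5) by simp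
    fix a b assume ab: "a \<in> set (y # vs)" "b \<in> set (y # vs)" "(a, b) \<in> flow_arcs f"
    then obtain e' where e': "e' \<in> E" "ends G e' = {a, b}" "a \<noteq> b" "f e' = Some a"
      unfolding flow_arcs_def by auto
    have "e' \<noteq> e" using e' e ab Cons.prems(2) by auto
    then show "(a, b) \<in> flow_arcs ?g" using e' unfolding flow_arcs_def push_def by auto
  qed
  have "y \<in> V" "distinct (y # vs)" "last (y # vs) = v"
    using e ends_subset Cons.prems by auto
  from Cons.IH[OF g(1) this(2,3,1) succ] obtain f' es where f': "is_flow f'" "path_between G y (y # vs) es v"
    "\<forall>z. outflow f' z = outflow ?g z - of_bool (z = y) + of_bool (z = v)"
    "\<forall>e. f' e \<noteq> None \<longrightarrow> ?g e \<noteq> None \<and> e \<notin> set es" "\<forall>e\<in>set es. ?g e \<noteq> None"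
    by blast
  have "path_between G x (x # y # vs) (e # es) v"
    using path_between_Cons[OF f'(2) e(1,2)] Cons.prems by auto
  moreover have "\<forall>e'. f' e' \<noteq> None \<longrightarrow> f e' \<noteq> None \<and> e' \<notin> set (e # es)"
    using f'(4) unfolding ge by (metis fun_upd_apply set_ConsD)
  moreover have "\<forall>e'\<in>set (e # es). f e' \<noteq> None"
    using f'(5) e(4) unfolding ge by (auto split: if_splits)
  ultimately show ?case using f'(1,3) g(2)
    by (intro exI[of _ f'] exI[of _ "e # es"]) auto
qed

text \<open>No unit leaves the set reached along flow-carrying arcs, so its net outflow is at most 0
  unless it contains \<open>v\<close>. The last two conclusions make paths peeled off later
  edge-disjoint from this one.\<close>

lemma flow_path:
  assumes "is_flow f" "outflow f u = int (Suc n)" "\<And>z. z \<noteq> u \<Longrightarrow> z \<noteq> v \<Longrightarrow> outflow f z = 0"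
    "u \<in> V" "u \<noteq> v"
  obtains f' vs es where "is_flow f'" "path_between G u vs es v" "outflow f' u = int n"
    "\<And>z. z \<noteq> u \<Longrightarrow> z \<noteq> v \<Longrightarrow> outflow f' z = 0"
    "\<And>e. f' e \<noteq> None \<Longrightarrow> f e \<noteq> None \<and> e \<notin> set es" "\<And>e. e \<in> set es \<Longrightarrow> f e \<noteq> None"
proof -
  define Z where "Z = {z. (u, z) \<in> (flow_arcs f)\<^sup>*}"
  have arcs_V: "flow_arcs f \<subseteq> V \<times> V" using ends_subset unfolding flow_arcs_def by blast
  have "(u, z) \<in> (flow_arcs f)\<^sup>* \<Longrightarrow> z \<in> V" for z
    by (induction rule: rtrancl_induct) (use assms(4) arcs_V in auto)
  then have ZV: "Z \<subseteq> V" unfolding Z_def by blast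
  have uZ: "u \<in> Z" by (simp add: Z_def)
  have "v \<in> Z"
  proof (rule ccontr)
    assume v: "v \<notin> Z"
    have "(\<Sum>z\<in>Z. excess f e z) \<le> 0" if e: "e \<in> E" for e
    proof (cases "f e")
      case None
      then show ?thesis by (simp add: excess_def)
    next
      case (Some x)
      then have "x \<in> ends G e" using assms(1) e unfolding is_flow_def by auto
      then obtain y where y: "ends G e = {x, y}" "x \<noteq> y" using ends_other[OF e] by blast
      then have "(x, y) \<in> flow_arcs f" using Some e unfolding flow_arcs_def by auto
      then have "x \<in> Z \<Longrightarrow> y \<in> Z" unfolding Z_def by (auto intro: rtrancl.rtrancl_into_rtrancl)
      then show ?thesis using sum_excess[OF assms(1) e y Some ZV] by auto
    qed
    then have "(\<Sum>z\<in>Z. outflow f z) \<le> 0" unfolding sum_outflow_swap by (rule sum_nonpos)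
    then show False using sum_outflow_source[OF uZ v ZV] assms by auto
  qed
  then have "(u, v) \<in> (flow_arcs f)\<^sup>*" by (simp add: Z_def)
  from rtrancl_imp_distinct_walk[OF this] obtain vs where vs:
    "distinct (u # vs)" "last (u # vs) = v"
    "successively (\<lambda>a b. (a, b) \<in> flow_arcs f) (u # vs)"
    by blast
  obtain f' es where f': "is_flow f'" "path_between G u (u # vs) es v"
     "\<forall>z. outflow f' z = outflow f z - of_bool (z = u) + of_bool (z = v)"
     "\<forall>e. f' e \<noteq> None \<longrightarrow> f e \<noteq> None \<and> e \<notin> set es" "\<forall>e\<in>set es. f e \<noteq> None"
    using remove_walk[OF assms(1) vs(1,2) assms(4) vs(3)] by blast
  show ?thesis
    by (rule that[OF f'(1,2)]) (use f' assms in auto)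
qed

text \<open>The cut form of 3-edge-connectivity. Unlike the path form it is visibly an equivalence
  relation, and it is what the arguments about thin cuts use.\<close>

definition same_class :: "'v \<Rightarrow> 'v \<Rightarrow> bool" where
  "same_class u v \<longleftrightarrow> (\<forall>Z. card (edge_cut G Z) \<le> 2 \<longrightarrow> (u \<in> Z \<longleftrightarrow> v \<in> Z))"

text \<open>Menger's theorem for three paths: a flow of value 3 is peeled off path by path.\<close>

lemma same_class_imp_three_edge_connected:
  assumes "u \<in> V" "v \<in> V" "same_class u v"
  shows "three_edge_connected G u v"
proof (cases "u = v")
  case True
  then show ?thesis by (simp add: three_edge_connected_def)
next
  case False
  have "3 \<le> card (edge_cut G Z)" if uv: "u \<in> Z" "v \<notin> Z" for Z
    using assms(3) uv unfolding same_class_def by (metis not_less_eq_eq numeral_2_eq_2 numeral_3_eq_3)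
  then obtain f where f: "is_flow f" "outflow f u = int (Suc (Suc (Suc 0)))"
    "\<And>z. z \<noteq> u \<Longrightarrow> z \<noteq> v \<Longrightarrow> outflow f z = 0"
    using max_flow[OF assms(1,2) False, of 3] by (auto simp: numeral_3_eq_3)
  obtain f1 vs1 es1 where 1: "is_flow f1" "path_between G u vs1 es1 v" "outflow f1 u = int (Suc (Suc 0))"
    "\<And>z. z \<noteq> u \<Longrightarrow> z \<noteq> v \<Longrightarrow> outflow f1 z = 0"
    "\<And>e. f1 e \<noteq> None \<Longrightarrow> f e \<noteq> None \<and> e \<notin> set es1" "\<And>e. e \<in> set es1 \<Longrightarrow> f e \<noteq> None"
    using flow_path[OF f assms(1) False] by metis
  obtain f2 vs2 es2 where 2: "is_flow f2" "path_between G u vs2 es2 v" "outflow f2 u = int (Suc 0)"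
    "\<And>z. z \<noteq> u \<Longrightarrow> z \<noteq> v \<Longrightarrow> outflow f2 z = 0"
    "\<And>e. f2 e \<noteq> None \<Longrightarrow> f1 e \<noteq> None \<and> e \<notin> set es2" "\<And>e. e \<in> set es2 \<Longrightarrow> f1 e \<noteq> None"
    using flow_path[OF 1(1,3,4) assms(1) False] by metis
  obtain vs3 es3 where 3: "path_between G u vs3 es3 v" "\<And>e. e \<in> set es3 \<Longrightarrow> f2 e \<noteq> None"
    using flow_path[OF 2(1,3,4) assms(1) False] by metis
  have "set es1 \<inter> set es2 = {}" "set es1 \<inter> set es3 = {}" "set es2 \<inter> set es3 = {}"
    using 1(5) 2(5,6) 3(2) by blast+
  then show ?thesis using 1(2) 2(2) 3(1) unfolding three_edge_connected_def by blast
qed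

lemma three_edge_connected_imp_same_class:
  assumes "three_edge_connected G u v"
  shows "same_class u v"
proof (cases "u = v")
  case True
  then show ?thesis by (simp add: same_class_def)
next
  case False
  then obtain vs1 es1 vs2 es2 vs3 es3 where p:
    "path_between G u vs1 es1 v" "path_between G u vs2 es2 v" "path_between G u vs3 es3 v"
    "set es1 \<inter> set es2 = {}" "set es1 \<inter> set es3 = {}" "set es2 \<inter> set es3 = {}"
    using assms unfolding three_edge_connected_def by blast
  show ?thesis unfolding same_class_def
  proof (intro allI impI, rule ccontr)
    fix Z assume Z: "card (edge_cut G Z) \<le> 2" "(u \<in> Z) \<noteq> (v \<in> Z)"
    obtain e1 e2 e3 where e: "e1 \<in> set es1 \<inter> edge_cut G Z" "e2 \<in> set es2 \<inter> edge_cut G Z" "e3 \<in> set es3 \<inter> edge_cut G Z"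
      using p(1-3)[THEN path_meets_cut, of Z] Z(2) by blast
    then have "card {e1, e2, e3} = 3" using p(4-6) by (auto simp: card_insert_if)
    moreover have "card {e1, e2, e3} \<le> card (edge_cut G Z)"
      using e finite_cut by (intro card_mono) auto
    ultimately show False using Z(1) by simp
  qed
qed

end

subsection \<open>Duality between decompositions and brambles\<close>

locale cost_graph = fin_graph G for G :: "('v, 'e) mgraph" +
  fixes k :: nat
begin

text \<open>This is \<open>node_adh\<close> without a tree: the members of \<open>\<Pi>\<close> are
  the sides of the tree edges at one node. Edges lying in several cuts count once.\<close>

definition bold_cuts :: "'v set set \<Rightarrow> 'e set" where
  "bold_cuts \<Pi> = (\<Union>Q\<in>{Q \<in> \<Pi>. 3 \<le> card (edge_cut G Q)}. edge_cut G Q)"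

lemma finite_bold_cuts: "finite (bold_cuts \<Pi>)"
  by (rule finite_subset[OF _ finite_E]) (auto simp: bold_cuts_def edge_cut_def)

lemma bold_cuts_insert_empty: "bold_cuts (insert {} \<Pi>) = bold_cuts \<Pi>"
  unfolding bold_cuts_def using cut_empty by auto

definition pdisjoint :: "'v set set \<Rightarrow> bool" where
  "pdisjoint \<Pi> \<longleftrightarrow> (\<forall>P\<in>\<Pi>. \<forall>Q\<in>\<Pi>. P \<noteq> Q \<longrightarrow> P \<inter> Q = {})"

lemma pdisjoint_insert:
  "pdisjoint \<Pi> \<Longrightarrow> (\<And>Q. Q \<in> \<Pi> \<Longrightarrow> Q \<inter> R = {}) \<Longrightarrow> pdisjoint (insert R \<Pi>)"
  unfolding pdisjoint_def by (simp add: Int_commute)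

lemma pdisjoint_subset: "pdisjoint \<Pi> \<Longrightarrow> \<Pi>' \<subseteq> \<Pi> \<Longrightarrow> pdisjoint \<Pi>'"
  unfolding pdisjoint_def by (simp add: subset_iff)

lemma pdisjointD: "pdisjoint \<Pi> \<Longrightarrow> P \<in> \<Pi> \<Longrightarrow> Q \<in> \<Pi> \<Longrightarrow> P \<noteq> Q \<Longrightarrow> P \<inter> Q = {}"
  unfolding pdisjoint_def by simp

lemma pdisjoint_diff_image:
  assumes "pdisjoint \<Pi>"
  shows "pdisjoint ((\<lambda>Q. Q - S) ` \<Pi>)"
  unfolding pdisjoint_def
proof (intro ballI impI)
  fix P Q assume "P \<in> (\<lambda>Q. Q - S) ` \<Pi>" "Q \<in> (\<lambda>Q. Q - S) ` \<Pi>" "P \<noteq> Q"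
  then obtain P' Q' where "P' \<in> \<Pi>" "Q' \<in> \<Pi>" "P = P' - S" "Q = Q' - S" "P' \<noteq> Q'" by auto
  then show "P \<inter> Q = {}" using pdisjointD[OF assms, of P' Q'] by auto
qed

text \<open>\<open>derivable N P\<close> describes a tree-cut decomposition rooted at a tree edge with sides \<open>P\<close> and
  \<open>V - P\<close>, restricted to the side \<open>P\<close>: each node has a bag \<open>X\<close> and branches \<open>\<Pi>\<close>, and a leaf edge
  may be left open if the set behind it belongs to \<open>N\<close>.\<close>

inductive derivable :: "'v set set \<Rightarrow> 'v set \<Rightarrow> bool" for N where
  leaf: "P \<in> N \<Longrightarrow> P \<subseteq> V \<Longrightarrow> derivable N P"
| node: "P \<subseteq> V \<Longrightarrow> X \<union> \<Union>\<Pi> = P \<Longrightarrow> X \<inter> \<Union>\<Pi> = {} \<Longrightarrow> pdisjoint \<Pi> \<Longrightarrow> card X \<le> k \<Longrightarrow>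
     card (bold_cuts (insert (V - P) \<Pi>)) \<le> k \<Longrightarrow> (\<forall>Q\<in>\<Pi>. derivable N Q) \<Longrightarrow> derivable N P"

definition downclosed :: "'v set set \<Rightarrow> bool" where
  "downclosed N \<longleftrightarrow> (\<forall>P\<in>N. \<forall>Q. Q \<subseteq> P \<longrightarrow> Q \<in> N)"

lemma derivable_empty: "derivable N {}"
  by (rule derivable.node[of _ "{}" "{}"])
    (auto simp: pdisjoint_def bold_cuts_def cut_V)

text \<open>All sets occurring in a derivation of \<open>P\<close> are subsets of \<open>P\<close>,
  so the open leaf \<open>A\<close> cannot occur.\<close>

lemma derivable_insert_outside:
  assumes "derivable (insert A N) P" "\<not> A \<subseteq> P"
  shows "derivable N P"
  using assms
proof (induction rule: derivable.induct)
  case (leaf P)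
  then show ?case by (auto intro: derivable.leaf)
next
  case (node P X \<Pi>)
  have "\<forall>Q\<in>\<Pi>. derivable N Q" using node.IH node.prems node.hyps(2) by blast
  then show ?case using node.hyps by (intro derivable.node[of P X \<Pi>])
qed

text \<open>The path from the root edge to the open leaf \<open>A\<close> is reversed: at each node
  on it, the branch \<open>Q0\<close> containing \<open>A\<close> becomes the parent side, and
  \<open>V - P\<close> becomes a branch. The tree edges at the node, and with them
  \<open>bold_cuts\<close>, remain the same. As \<open>A\<close> is nonempty, only one of the
  disjoint branches can contain it.\<close>

lemma derivable_reroot:
  assumes "derivable (insert A N) P" "A \<noteq> {}"
  shows "derivable N P \<or> (derivable N (V - P) \<longrightarrow> derivable N (V - A))"
  using assms(1)
proof (induction rule: derivable.induct)
  case (leaf P)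
  then show ?case by (auto intro: derivable.leaf)
next
  case (node P X \<Pi>)
  show ?case
  proof (cases "\<exists>Q\<in>\<Pi>. A \<subseteq> Q")
    case False
    then have "\<forall>Q\<in>\<Pi>. derivable N Q" using node.IH by (auto intro: derivable_insert_outside)
    then have "derivable N P" using node.hyps by (intro derivable.node[of P X \<Pi>])
    then show ?thesis by blast
  next
    case True
    then obtain Q0 where Q0: "Q0 \<in> \<Pi>" "A \<subseteq> Q0" by blast
    have others: "\<forall>Q\<in>\<Pi> - {Q0}. derivable N Q"
    proof
      fix Q assume "Q \<in> \<Pi> - {Q0}"
      then have Q: "Q \<in> \<Pi>" "Q \<inter> Q0 = {}" using Q0(1) pdisjointD[OF node.hyps(4)] by auto
      then have "\<not> A \<subseteq> Q" using Q0(2) assms(2) by auto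
      then show "derivable N Q" using node.IH Q(1) by (auto intro: derivable_insert_outside)
    qed
    have root: "derivable N (V - Q0)" if P: "derivable N (V - P)"
    proof (rule derivable.node[of _ X "insert (V - P) (\<Pi> - {Q0})"])
      have Q0P: "Q0 \<subseteq> P" "P \<subseteq> V" using Q0 node.hyps by auto
      have dis: "Q \<inter> Q0 = {}" if "Q \<in> \<Pi> - {Q0}" for Q
        using that Q0(1) pdisjointD[OF node.hyps(4)] by auto
      show "X \<union> \<Union> (insert (V - P) (\<Pi> - {Q0})) = V - Q0"
      proof (intro equalityI subsetI)
        fix x assume "x \<in> X \<union> \<Union> (insert (V - P) (\<Pi> - {Q0}))"
        then consider "x \<in> X" | "x \<in> V - P" | Q where "Q \<in> \<Pi> - {Q0}" "x \<in> Q" by blast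
        then show "x \<in> V - Q0"
        proof cases
          case 3
          then show ?thesis using dis[of Q] node.hyps(1,2) by blast
        qed (use node.hyps(1-3) Q0(1) in blast)+
      next
        fix x assume "x \<in> V - Q0"
        then show "x \<in> X \<union> \<Union> (insert (V - P) (\<Pi> - {Q0}))" using node.hyps(2) by blast
      qed
      show "X \<inter> \<Union> (insert (V - P) (\<Pi> - {Q0})) = {}" using node.hyps(2,3) by blast
      show "pdisjoint (insert (V - P) (\<Pi> - {Q0}))"
        using node.hyps(2) by (intro pdisjoint_insert pdisjoint_subset[OF node.hyps(4)]) auto
      have "V - (V - Q0) = Q0" using Q0P by blast
      then have "insert (V - (V - Q0)) (insert (V - P) (\<Pi> - {Q0})) = insert (V - P) \<Pi>"
        using Q0 by auto
      then show "card (bold_cuts (insert (V - (V - Q0)) (insert (V - P) (\<Pi> - {Q0})))) \<le> k"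
        using node.hyps by simp
      show "\<forall>Q\<in>insert (V - P) (\<Pi> - {Q0}). derivable N Q" using others P by blast
    qed (use node.hyps(5) in simp_all)
    have "derivable N Q0 \<or> (derivable N (V - Q0) \<longrightarrow> derivable N (V - A))"
      using node.IH Q0(1) by blast
    then show ?thesis
    proof
      assume "derivable N Q0"
      then have "\<forall>Q\<in>\<Pi>. derivable N Q" using others by blast
      then have "derivable N P" using node.hyps by (intro derivable.node[of P X \<Pi>])
      then show ?thesis by blast
    qed (use root in blast)
  qed
qed

text \<open>The form in which all uncrossing inequalities are checked edge by edge: an edge counted
  on the left is counted on the right, and one counted twice is counted twice.\<close>

lemma card_Un_Int_le:
  assumes "finite A" "finite B" "finite C" "finite D" "A \<union> B \<subseteq> C \<union> D" "A \<inter> B \<subseteq> C \<inter> D"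
  shows "card A + card B \<le> card C + card D"
proof -
  have "card A + card B = card (A \<union> B) + card (A \<inter> B)" using assms by (intro card_Un_Int)
  also have "\<dots> \<le> card (C \<union> D) + card (C \<inter> D)" using assms by (intro add_mono card_mono) auto
  also have "\<dots> = card C + card D" using assms by (intro card_Un_Int[symmetric])
  finally show ?thesis .
qed

lemma cut_submodular:
  "card (edge_cut G (U \<union> S)) + card (edge_cut G (U \<inter> S)) \<le> card (edge_cut G U) + card (edge_cut G S)"
  by (intro card_Un_Int_le finite_cut) (auto simp: edge_cut_def)

lemma cut_posimodular:
  "card (edge_cut G (U - S)) + card (edge_cut G (S - U)) \<le> card (edge_cut G U) + card (edge_cut G S)"
  by (intro card_Un_Int_le finite_cut) (auto simp: edge_cut_def)

text \<open>Taking \<open>W\<close> to be \<open>U\<close>, or all of \<open>V\<close> outside the bold parts if \<open>U\<close> is thin, the new bold cuts and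
  \<open>edge_cut G (S \<inter> W)\<close> are together at most as large as the old bold cuts and \<open>edge_cut G S\<close>.\<close>

lemma bold_cuts_uncross:
  assumes "A \<subseteq> S" "\<And>S'. A \<subseteq> S' \<Longrightarrow> S' \<subseteq> S \<Longrightarrow> card (edge_cut G S) \<le> card (edge_cut G S')"
    and "A \<subseteq> U" "S \<subseteq> V" "\<And>Q. Q \<in> \<Pi> \<Longrightarrow> Q \<inter> U = {}"
  shows "card (bold_cuts (insert (U \<union> S) ((\<lambda>Q. Q - S) ` \<Pi>))) \<le> card (bold_cuts (insert U \<Pi>))"
proof -
  define H where "H = {Q \<in> \<Pi>. 3 \<le> card (edge_cut G Q)}"
  define W where "W = (if 3 \<le> card (edge_cut G U) then U else V - \<Union>H)"
  have AW: "A \<subseteq> W" using assms(1,3,4) assms(5) unfolding W_def H_def by (auto split: if_splits; blast)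
  have WH: "W \<inter> Q = {}" if "Q \<in> H" for Q using that assms(5) unfolding W_def H_def by auto
  \<comment> \<open>No single cut grows, so a set that is bold after uncrossing comes from one that
    was bold before. For the branches this uses posimodularity, since \<open>A\<close> lies in
    \<open>S - Q\<close>.\<close>
  have U_thin: "card (edge_cut G (U \<union> S)) \<le> card (edge_cut G U)"
    using cut_submodular[of U S] assms(2)[of "U \<inter> S"] assms(1,3) by auto
  have Q_thin: "card (edge_cut G (Q - S)) \<le> card (edge_cut G Q)" if "Q \<in> \<Pi>" for Q
  proof -
    have "A \<subseteq> S - Q" using assms(1,3) assms(5)[OF that] by blast
    then show ?thesis using cut_posimodular[of Q S] assms(2)[of "S - Q"] by auto
  qed
  let ?E1 = "bold_cuts (insert (U \<union> S) ((\<lambda>Q. Q - S) ` \<Pi>))"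
  let ?E0 = "bold_cuts (insert U \<Pi>)"
  have E0H: "edge_cut G Q \<subseteq> ?E0" if "Q \<in> H" for Q
    using that unfolding bold_cuts_def H_def by blast
  have E0U: "edge_cut G U \<subseteq> ?E0" if "3 \<le> card (edge_cut G U)"
    using that unfolding bold_cuts_def by blast
  have E0W: "edge_cut G W \<subseteq> ?E0"
  proof (cases "3 \<le> card (edge_cut G U)")
    case False
    show ?thesis
    proof
      fix e assume "e \<in> edge_cut G W"
      then obtain x y where e: "e \<in> E" "ends G e = {x, y}" "x \<in> W" "y \<notin> W" "y \<in> V" by (elim cutE)
      then obtain Q where "Q \<in> H" "y \<in> Q" using False unfolding W_def by auto
      then show "e \<in> ?E0" using WH e E0H[of Q] cut_pair_iff[OF e(1,2), of Q] by blast
    qed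
  qed (use E0U W_def in auto)
  have E1: "(3 \<le> card (edge_cut G U) \<and> e \<in> edge_cut G (U \<union> S)) \<or> (\<exists>Q\<in>H. e \<in> edge_cut G (Q - S))"
    if e: "e \<in> ?E1" for e
  proof -
    obtain R where R: "R \<in> insert (U \<union> S) ((\<lambda>Q. Q - S) ` \<Pi>)" "3 \<le> card (edge_cut G R)" "e \<in> edge_cut G R"
      using e unfolding bold_cuts_def by blast
    then consider "R = U \<union> S" | Q where "Q \<in> \<Pi>" "R = Q - S" by blast
    then show ?thesis
    proof cases
      case 1
      then show ?thesis using R U_thin by auto
    next
      case (2 Q)
      then have "Q \<in> H" using R Q_thin[of Q] unfolding H_def by auto
      then show ?thesis using 2 R by auto
    qed
  qed
  have "card ?E1 + card (edge_cut G (S \<inter> W)) \<le> card ?E0 + card (edge_cut G S)"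
  proof (intro card_Un_Int_le finite_cut finite_bold_cuts; intro subsetI)
    fix e assume "e \<in> ?E1 \<union> edge_cut G (S \<inter> W)"
    then show "e \<in> ?E0 \<union> edge_cut G S"
    proof
      assume "e \<in> ?E1"
      from E1[OF this] show ?thesis
      proof (elim disjE conjE bexE)
        assume "3 \<le> card (edge_cut G U)" "e \<in> edge_cut G (U \<union> S)"
        then show ?thesis using E0U by (auto simp: edge_cut_def)
      next
        fix Q assume "Q \<in> H" "e \<in> edge_cut G (Q - S)"
        then show ?thesis using E0H[of Q] by (auto simp: edge_cut_def)
      qed
    next
      assume "e \<in> edge_cut G (S \<inter> W)"
      then show ?thesis using E0W by (auto simp: edge_cut_def)
    qed
  next
    fix e assume "e \<in> ?E1 \<inter> edge_cut G (S \<inter> W)"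
    then have e1: "e \<in> ?E1" and e2: "e \<in> edge_cut G (S \<inter> W)" by auto
    from e2 obtain x y where e: "e \<in> E" "ends G e = {x, y}" "x \<in> S" "x \<in> W" "y \<notin> S \<inter> W"
      by (auto elim!: cutE)
    from E1[OF e1] show "e \<in> ?E0 \<inter> edge_cut G S"
    proof (elim disjE conjE bexE)
      assume U: "3 \<le> card (edge_cut G U)" "e \<in> edge_cut G (U \<union> S)"
      then have "y \<notin> U \<union> S" using e cut_pair_iff[OF e(1,2)] by auto
      moreover have "x \<in> U" using e(4) U(1) unfolding W_def by simp
      ultimately show ?thesis using E0U[OF U(1)] e cut_pair_iff[OF e(1,2)] by auto
    next
      fix Q assume Q: "Q \<in> H" "e \<in> edge_cut G (Q - S)"
      then have "y \<in> Q - S" using e cut_pair_iff[OF e(1,2)] by auto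
      moreover have "x \<notin> Q" using WH[OF Q(1)] e by auto
      ultimately show ?thesis using E0H[OF Q(1)] e cut_pair_iff[OF e(1,2)] by auto
    qed
  qed
  \<comment> \<open>\<open>S \<inter> W\<close> lies between \<open>A\<close> and \<open>S\<close>,
    so the minimality of \<open>S\<close> cancels the two single cuts in the inequality.\<close>
  moreover have "card (edge_cut G S) \<le> card (edge_cut G (S \<inter> W))" using assms AW by auto
  ultimately show ?thesis by linarith
qed

text \<open>All of \<open>S\<close> is moved to the root side of every tree edge. The complement of
  each set in the derivation contains \<open>A\<close>, so \<open>bold_cuts_uncross\<close> bounds
  the cost of each node; down-closedness keeps the shrunken open leaves in \<open>N\<close>.\<close>

lemma derivable_uncross:
  assumes "derivable N P" "downclosed N" "P \<inter> A = {}" "A \<subseteq> S" "S \<subseteq> V"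
    "\<And>S'. A \<subseteq> S' \<Longrightarrow> S' \<subseteq> S \<Longrightarrow> card (edge_cut G S) \<le> card (edge_cut G S')"
  shows "derivable N (P - S)"
  using assms(1,3)
proof (induction rule: derivable.induct)
  case (leaf P)
  have "P - S \<in> N" using leaf assms(2) unfolding downclosed_def by blast
  then show ?case using leaf by (intro derivable.leaf) auto
next
  case (node P X \<Pi>)
  have UP: "V - (P - S) = (V - P) \<union> S" using assms(5) by blast
  have "card (bold_cuts (insert ((V - P) \<union> S) ((\<lambda>Q. Q - S) ` \<Pi>))) \<le> card (bold_cuts (insert (V - P) \<Pi>))"
    using assms(4,5,6) node.hyps(2) node.prems by (intro bold_cuts_uncross[of A]) auto
  then have c: "card (bold_cuts (insert (V - (P - S)) ((\<lambda>Q. Q - S) ` \<Pi>))) \<le> k"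
    using node.hyps UP by simp
  have finX: "finite X" using node.hyps(1,2) finite_V by (auto intro: finite_subset)
  show ?case
  proof (rule derivable.node[of _ "X - S" "(\<lambda>Q. Q - S) ` \<Pi>"])
    show "card (X - S) \<le> k" using card_mono[OF finX, of "X - S"] node.hyps by auto
    show "pdisjoint ((\<lambda>Q. Q - S) ` \<Pi>)" by (rule pdisjoint_diff_image[OF node.hyps(4)])
    have "Q \<inter> A = {}" if "Q \<in> \<Pi>" for Q using that node.prems node.hyps(2) by blast
    then show "\<forall>Q\<in>(\<lambda>Q. Q - S) ` \<Pi>. derivable N Q" using node.IH by simp
    show "X - S \<union> \<Union> ((\<lambda>Q. Q - S) ` \<Pi>) = P - S" using node.hyps(2) by blast
    show "(X - S) \<inter> \<Union> ((\<lambda>Q. Q - S) ` \<Pi>) = {}" using node.hyps(3) by blast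
  qed (use node.hyps(1) c in blast)+
qed

lemma derivable_insert_empty: "derivable (insert {} N) P \<Longrightarrow> derivable N P"
proof (induction rule: derivable.induct)
  case (leaf P)
  then show ?case using derivable_empty by (auto intro: derivable.leaf)
next
  case (node P X \<Pi>)
  have "\<forall>Q\<in>\<Pi>. derivable N Q" using node.IH by blast
  then show ?case using node.hyps by (intro derivable.node[of P X \<Pi>])
qed

text \<open>As \<open>S \<notin> N\<close>, the derivation of \<open>S\<close> ends in a node rather
  than an open leaf. Its parent side \<open>V - S\<close> is turned into a branch, and the new
  parent side is empty.\<close>

lemma derivable_glue:
  assumes "derivable N S" "S \<notin> N" "derivable N (V - S)"
  shows "derivable N V"
  using assms(1)
proof (cases rule: derivable.cases)
  case (node X \<Pi>)
  show ?thesis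
  proof (rule derivable.node[of _ X "insert (V - S) \<Pi>"])
    show "pdisjoint (insert (V - S) \<Pi>)" using node(2) by (intro pdisjoint_insert[OF node(4)]) auto
    show "card (bold_cuts (insert (V - V) (insert (V - S) \<Pi>))) \<le> k"
      using node bold_cuts_insert_empty by simp
    show "X \<union> \<Union> (insert (V - S) \<Pi>) = V" using node(1,2) by blast
    show "X \<inter> \<Union> (insert (V - S) \<Pi>) = {}" using node(1,2,3) by blast
    show "\<forall>Q\<in>insert (V - S) \<Pi>. derivable N Q" using node(7) assms(3) by blast
  qed (use node(5) in simp_all)
qed (use assms(2) in blast)

text \<open>The bramble consists of the subsets of \<open>V\<close> outside the maximal
  \<open>N\<close>. If every branch of an affordable star were in \<open>N\<close>, a single node
  with open leaves would derive \<open>V\<close>.\<close>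

theorem bramble_exists:
  assumes "\<not> derivable {} V"
  obtains B where
    "\<And>P Q. P \<in> B \<Longrightarrow> Q \<in> B \<Longrightarrow> P \<inter> Q \<noteq> {}"
    "\<And>P. P \<in> B \<Longrightarrow> P \<subseteq> V"
    "\<And>X \<Pi>. X \<union> \<Union>\<Pi> = V \<Longrightarrow> X \<inter> \<Union>\<Pi> = {} \<Longrightarrow> pdisjoint \<Pi> \<Longrightarrow> card X \<le> k \<Longrightarrow>
       card (bold_cuts \<Pi>) \<le> k \<Longrightarrow> \<exists>Q\<in>\<Pi>. Q \<in> B"
proof -
  \<comment> \<open>Demanding \<open>{} \<in> N\<close> makes every set outside \<open>N\<close>
    nonempty, which \<open>derivable_reroot\<close> requires.\<close>
  define \<N> where "\<N> = {N. N \<subseteq> Pow V \<and> downclosed N \<and> {} \<in> N \<and> \<not> derivable N V}"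
  have "finite \<N>"
    unfolding \<N>_def by (rule finite_subset[of _ "Pow (Pow V)"]) (use finite_V in auto)
  moreover have "{{}} \<in> \<N>"
    using assms derivable_insert_empty[of "{}"] unfolding \<N>_def downclosed_def by auto
  then have "\<N> \<noteq> {}" by blast
  ultimately obtain N where "N \<in> \<N>" and max: "\<And>N'. N' \<in> \<N> \<Longrightarrow> N \<subseteq> N' \<Longrightarrow> N = N'"
    using finite_has_maximal[of \<N>] by auto
  then have N: "N \<subseteq> Pow V" "downclosed N" "{} \<in> N" "\<not> derivable N V"
    unfolding \<N>_def by auto
  \<comment> \<open>All proper subsets of \<open>A\<close> are in \<open>N\<close>, so adding
    \<open>A\<close> keeps the family down-closed, and by maximality a decomposition with open leaf
    \<open>A\<close> appears. Seen from that leaf it decomposes \<open>V - A\<close>.\<close>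
  have minimal: "derivable N (V - A)"
    if A: "A \<subseteq> V" "A \<notin> N" "\<And>Q. Q \<subset> A \<Longrightarrow> Q \<in> N" for A
  proof -
    have "insert A N \<notin> \<N>" using max[of "insert A N"] A(2) by auto
    moreover have "downclosed (insert A N)"
      using N(2) A(3) unfolding downclosed_def by (auto simp: psubset_eq)
    ultimately have d: "derivable (insert A N) V" using N(1,3) A(1) unfolding \<N>_def by auto
    have "A \<noteq> {}" using N(3) A(2) by auto
    from derivable_reroot[OF d this] show ?thesis using N(4) derivable_empty[of N] by simp
  qed
  have shrink: "\<exists>A. A \<subseteq> P \<and> A \<notin> N \<and> (\<forall>Q. Q \<subset> A \<longrightarrow> Q \<in> N)" if P: "P \<subseteq> V" "P \<notin> N" for P
  proof -
    define M where "M = {A. A \<subseteq> P \<and> A \<notin> N}"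
    have "finite M" unfolding M_def by (rule finite_subset[of _ "Pow V"]) (use P finite_V in auto)
    moreover have "M \<noteq> {}" using P unfolding M_def by blast
    ultimately obtain A where A: "A \<in> M" "\<forall>Q\<in>M. Q \<subseteq> A \<longrightarrow> A = Q"
      using finite_has_minimal[of M] by auto
    have "Q \<in> N" if Q: "Q \<subset> A" for Q
    proof (rule ccontr)
      assume "Q \<notin> N"
      then have "Q \<in> M" using Q A(1) unfolding M_def by auto
      then show False using A(2) Q by auto
    qed
    then show ?thesis using A(1) unfolding M_def by auto
  qed
  show ?thesis
  proof (rule that[of "{P. P \<subseteq> V \<and> P \<notin> N}"])
    fix X \<Pi> assume p: "X \<union> \<Union>\<Pi> = V" "X \<inter> \<Union>\<Pi> = {}" "pdisjoint \<Pi>" "card X \<le> k"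
       "card (bold_cuts \<Pi>) \<le> k"
    show "\<exists>Q\<in>\<Pi>. Q \<in> {P. P \<subseteq> V \<and> P \<notin> N}"
    proof (rule ccontr)
      assume "\<not> ?thesis"
      then have "\<forall>Q\<in>\<Pi>. derivable N Q" using p(1) by (auto intro!: derivable.leaf)
      then have "derivable N V"
        using p bold_cuts_insert_empty by (intro derivable.node[of _ X \<Pi>]) auto
      then show False using N(4) by contradiction
    qed
  next
    fix P Q assume PQ: "P \<in> {P. P \<subseteq> V \<and> P \<notin> N}" "Q \<in> {P. P \<subseteq> V \<and> P \<notin> N}"
    show "P \<inter> Q \<noteq> {}"
    proof
      assume dis: "P \<inter> Q = {}"
      obtain A where A: "A \<subseteq> P" "A \<notin> N" "\<And>Q. Q \<subset> A \<Longrightarrow> Q \<in> N" using shrink[of P] PQ by auto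
      obtain B where B: "B \<subseteq> Q" "B \<notin> N" "\<And>Q. Q \<subset> B \<Longrightarrow> Q \<in> N" using shrink[of Q] PQ by auto
      have AB: "A \<subseteq> V" "B \<subseteq> V" "A \<inter> B = {}" using A B PQ dis by auto
      have "A \<subseteq> A \<and> A \<subseteq> V - B" using AB by blast
      then have "\<exists>S. (A \<subseteq> S \<and> S \<subseteq> V - B) \<and>
          (\<forall>S'. A \<subseteq> S' \<and> S' \<subseteq> V - B \<longrightarrow> card (edge_cut G S) \<le> card (edge_cut G S'))"
        by (rule ex_has_least_nat)
      then obtain S where S: "A \<subseteq> S" "S \<subseteq> V - B"
        "\<And>S'. A \<subseteq> S' \<Longrightarrow> S' \<subseteq> V - B \<Longrightarrow> card (edge_cut G S) \<le> card (edge_cut G S')"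
        by (elim exE conjE) metis
      \<comment> \<open>A minimum cut between \<open>A\<close> and \<open>B\<close> is in particular
        minimal among the sets between \<open>A\<close> and \<open>S\<close>, which is all that
        uncrossing asks; \<open>V - S\<close> has the same property with respect to
        \<open>B\<close>.\<close>
      have "derivable N ((V - A) - S)"
      proof (rule derivable_uncross[OF minimal[OF AB(1) A(2,3)] N(2), of A])
        fix S' assume S': "A \<subseteq> S'" "S' \<subseteq> S"
        then show "card (edge_cut G S) \<le> card (edge_cut G S')" using S(2) by (intro S(3)) auto
      qed (use S(1,2) in auto)
      moreover have "(V - A) - S = V - S" using S(1) by blast
      ultimately have d1: "derivable N (V - S)" by simp
      have d2: "derivable N ((V - B) - (V - S))"
      proof (rule derivable_uncross[OF minimal[OF AB(2) B(2,3)] N(2), of B])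
        fix S' assume S': "B \<subseteq> S'" "S' \<subseteq> V - S"
        then have "card (edge_cut G S) \<le> card (edge_cut G (V - S'))" using S(1,2) AB by (intro S(3)) auto
        then show "card (edge_cut G (V - S)) \<le> card (edge_cut G S')" by (simp add: cut_compl)
      qed (use S(1,2) AB in auto)
      have "(V - B) - (V - S) = S" using S(2) by blast
      then have "derivable N S" using d2 by simp
      moreover have "S \<notin> N" using A(2) S(1) N(2) unfolding downclosed_def by auto
      ultimately show False using derivable_glue[of N S] d1 N(4) by blast
    qed
  qed auto
qed

end

context fin_graph
begin

subsection \<open>Connected sets and classes\<close>

text \<open>Connectivity is expressed by cuts because it is used to find an edge inside
  \<open>K\<close> that crosses a given set.\<close>

definition connected_set :: "'v set \<Rightarrow> bool" where
  "connected_set K \<longleftrightarrow>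
     (\<forall>Z. K \<inter> Z \<noteq> {} \<longrightarrow> K - Z \<noteq> {} \<longrightarrow> (\<exists>e\<in>E. ends G e \<subseteq> K \<and> e \<in> edge_cut G Z))"

lemma connected_setE:
  assumes "connected_set K" "x \<in> K" "x \<in> Z" "y \<in> K" "y \<notin> Z"
  obtains e p q where "e \<in> E" "ends G e = {p, q}" "p \<in> K" "q \<in> K" "p \<in> Z" "q \<notin> Z"
proof -
  have "K \<inter> Z \<noteq> {}" "K - Z \<noteq> {}" using assms by auto
  then obtain e where e: "ends G e \<subseteq> K" "e \<in> edge_cut G Z"
    using assms(1) unfolding connected_set_def by blast
  then obtain p q where "e \<in> E" "ends G e = {p, q}" "p \<in> Z" "q \<notin> Z" by (elim cutE)
  then show ?thesis using that e(1) by auto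
qed

definition inner_adj :: "'v set \<Rightarrow> ('v \<times> 'v) set" where
  "inner_adj W = {(x, y). x \<in> W \<and> y \<in> W \<and> (\<exists>e\<in>E. ends G e = {x, y})}"

definition component :: "'v set \<Rightarrow> 'v \<Rightarrow> 'v set" where
  "component W x = {y. (x, y) \<in> (inner_adj W)\<^sup>*}"

lemma inner_adj_rtrancl_sym: "(x, y) \<in> (inner_adj W)\<^sup>* \<Longrightarrow> (y, x) \<in> (inner_adj W)\<^sup>*"
proof -
  have "sym (inner_adj W)" unfolding inner_adj_def sym_def by (auto simp: insert_commute)
  then show "(x, y) \<in> (inner_adj W)\<^sup>* \<Longrightarrow> (y, x) \<in> (inner_adj W)\<^sup>*"
    using sym_rtrancl[of "inner_adj W"] by (auto dest: symD)
qed

lemma component_self: "x \<in> component W x"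
  unfolding component_def by simp

lemma component_subset: "x \<in> W \<Longrightarrow> component W x \<subseteq> W"
proof
  fix y assume "x \<in> W" "y \<in> component W x"
  then have "(x, y) \<in> (inner_adj W)\<^sup>*" by (simp add: component_def)
  then show "y \<in> W" by (cases rule: rtranclE) (use \<open>x \<in> W\<close> in \<open>auto simp: inner_adj_def\<close>)
qed

lemma component_eq: "y \<in> component W x \<Longrightarrow> component W y = component W x"
  unfolding component_def using inner_adj_rtrancl_sym[of x y W]
  by (auto intro: rtrancl_trans)

lemma component_step:
  assumes "y \<in> component W x" "x \<in> W" "e \<in> E" "ends G e = {y, z}" "z \<in> W"
  shows "z \<in> component W x"
proof -
  have "y \<in> W" using assms(1) component_subset[OF assms(2)] by blast
  then have "(y, z) \<in> inner_adj W" using assms unfolding inner_adj_def by auto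
  then show ?thesis using assms(1) unfolding component_def by (auto intro: rtrancl_into_rtrancl)
qed

lemma component_connected: "connected_set (component W x)"
  unfolding connected_set_def
proof (intro allI impI)
  fix Z assume "component W x \<inter> Z \<noteq> {}" "component W x - Z \<noteq> {}"
  then obtain p q where pq: "p \<in> component W x" "p \<in> Z" "q \<in> component W x" "q \<notin> Z" by blast
  have "q \<in> component W p" using pq component_eq by auto
  then have r: "(p, q) \<in> (inner_adj W)\<^sup>*" by (simp add: component_def)
  show "\<exists>e\<in>E. ends G e \<subseteq> component W x \<and> e \<in> edge_cut G Z"
  proof (rule ccontr)
    assume no: "\<not> ?thesis"
    from r have "q \<in> Z \<and> q \<in> component W x"
    proof (induction rule: rtrancl_induct)
      case base
      then show ?case using pq by simp
    next
      case (step y z)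
      then obtain e where e: "e \<in> E" "ends G e = {y, z}" unfolding inner_adj_def by auto
      have z: "z \<in> component W x" using step unfolding component_def by (auto intro: rtrancl_into_rtrancl)
      then have "e \<notin> edge_cut G Z" using no e step by auto
      then show ?case using e step z cut_pair_iff[OF e] by auto
    qed
    then show False using pq by simp
  qed
qed

lemma connected_union_edge:
  assumes "connected_set K" "connected_set L" "e \<in> E" "ends G e = {p, q}" "p \<in> K" "q \<in> L"
  shows "connected_set (K \<union> L)"
  unfolding connected_set_def
proof (intro allI impI, rule ccontr)
  fix Z assume Z: "(K \<union> L) \<inter> Z \<noteq> {}" "(K \<union> L) - Z \<noteq> {}"
    and no: "\<not> (\<exists>e\<in>E. ends G e \<subseteq> K \<union> L \<and> e \<in> edge_cut G Z)"
  have K: "K \<inter> Z = {} \<or> K - Z = {}"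
  proof (rule ccontr)
    assume "\<not> ?thesis"
    then obtain e where "e \<in> E" "ends G e \<subseteq> K" "e \<in> edge_cut G Z"
      using assms(1)[unfolded connected_set_def, rule_format, of Z] by auto
    then show False using no by auto
  qed
  have L: "L \<inter> Z = {} \<or> L - Z = {}"
  proof (rule ccontr)
    assume "\<not> ?thesis"
    then obtain e where "e \<in> E" "ends G e \<subseteq> L" "e \<in> edge_cut G Z"
      using assms(2)[unfolded connected_set_def, rule_format, of Z] by auto
    then show False using no by auto
  qed
  have "p \<in> Z \<longleftrightarrow> q \<in> Z" using no assms cut_pair_iff[OF assms(3,4)] by auto
  then show False using K L Z assms(5,6) by blast
qed

definition cls :: "'v \<Rightarrow> 'v set" where
  "cls u = {v \<in> V. same_class u v}"

lemma cls_self: "u \<in> V \<Longrightarrow> u \<in> cls u"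
  unfolding cls_def same_class_def by simp

lemma cls_subset: "cls u \<subseteq> V"
  unfolding cls_def by blast

lemma cls_thin: "card (edge_cut G Z) \<le> 2 \<Longrightarrow> v \<in> cls u \<Longrightarrow> w \<in> cls u \<Longrightarrow> v \<in> Z \<longleftrightarrow> w \<in> Z"
  unfolding cls_def same_class_def by blast

text \<open>Each of the two cuts loses an edge and keeps at most one. The edges \<open>e\<close> and
  \<open>f\<close> may coincide.\<close>

lemma card_cut_union:
  assumes "card (edge_cut G Z) \<le> 2" "card (edge_cut G Z') \<le> 2"
    "e \<in> edge_cut G Z" "e \<notin> edge_cut G (Z \<union> Z')" "f \<in> edge_cut G Z'" "f \<notin> edge_cut G (Z \<union> Z')"
  shows "card (edge_cut G (Z \<union> Z')) \<le> 2"
proof -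
  have "edge_cut G (Z \<union> Z') \<subseteq> (edge_cut G Z - {e}) \<union> (edge_cut G Z' - {f})"
    using assms(4,6) unfolding edge_cut_def by auto
  then have "card (edge_cut G (Z \<union> Z')) \<le> card ((edge_cut G Z - {e}) \<union> (edge_cut G Z' - {f}))"
    using finite_cut by (intro card_mono) auto
  also have "\<dots> \<le> card (edge_cut G Z - {e}) + card (edge_cut G Z' - {f})" by (rule card_Un_le)
  also have "\<dots> \<le> 1 + 1"
    using assms(1,2) card_Diff_singleton[OF assms(3)] card_Diff_singleton[OF assms(5)] by auto
  finally show ?thesis by simp
qed

text \<open>Every vertex of the component lies in a connected thin set avoiding the class, and a union of
  two adjacent such sets is again thin.\<close>

lemma component_thin:
  assumes u: "u \<in> V" and x: "x \<in> V - cls u"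
  shows "card (edge_cut G (component (V - cls u) x)) \<le> 2"
proof -
  define S where "S = component (V - cls u) x"
  have SV: "S \<subseteq> V - cls u" using component_subset[OF x] by (simp add: S_def)
  have cutS: "q \<in> cls u" if "e \<in> E" "ends G e = {p, q}" "p \<in> S" "q \<notin> S" for e p q
    using component_step[OF _ x, of p e q] that ends_subset[of e] unfolding S_def by auto
  have thin_part: "\<exists>Z. Z \<subseteq> S \<and> connected_set Z \<and> card (edge_cut G Z) \<le> 2 \<and> y \<in> Z" if y: "y \<in> S" for y
  proof -
    have "\<not> same_class u y" using y SV unfolding cls_def by auto
    then obtain Z where Z: "card (edge_cut G Z) \<le> 2" "(u \<in> Z) \<noteq> (y \<in> Z)"
      unfolding same_class_def by auto
    \<comment> \<open>The side of the thin cut that contains \<open>y\<close>; it misses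
      \<open>u\<close> and hence the whole class.\<close>
    define Z1 where "Z1 = (if y \<in> Z then Z else V - Z)"
    have Z1: "card (edge_cut G Z1) \<le> 2" "y \<in> Z1" "u \<notin> Z1"
      using Z y SV u unfolding Z1_def by (auto simp: cut_compl)
    have dis: "cls u \<inter> Z1 = {}" using cls_thin[OF Z1(1), of u u] cls_self[OF u] Z1(3) by auto
    \<comment> \<open>Passing to a component inside \<open>S\<close> creates no new cut edge: an
      edge leaving \<open>S\<close> ends in the class, hence outside \<open>Z1\<close>.\<close>
    let ?K = "component (Z1 \<inter> S) y"
    have yW: "y \<in> Z1 \<inter> S" using Z1 y by auto
    have "edge_cut G ?K \<subseteq> edge_cut G Z1"
    proof
      fix e assume "e \<in> edge_cut G ?K"
      then obtain p q where e: "e \<in> E" "ends G e = {p, q}" "p \<in> ?K" "q \<notin> ?K" by (elim cutE)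
      have p: "p \<in> Z1" "p \<in> S" using e(3) component_subset[OF yW] by auto
      have "q \<notin> Z1 \<inter> S" using component_step[OF e(3) yW e(1,2)] e(4) by auto
      then have "q \<notin> Z1" using cutS[OF e(1,2) p(2)] dis by auto
      then show "e \<in> edge_cut G Z1" using cutI[OF e(1,2) p(1)] by auto
    qed
    then have "card (edge_cut G ?K) \<le> 2"
      using card_mono[OF finite_cut] Z1(1) by (meson le_trans)
    moreover have "?K \<subseteq> S" using component_subset[OF yW] by auto
    ultimately show ?thesis using component_connected component_self by blast
  qed
  define \<Z> where "\<Z> = {Z. Z \<subseteq> S \<and> connected_set Z \<and> card (edge_cut G Z) \<le> 2 \<and> x \<in> Z}"
  have "x \<in> S" unfolding S_def by (rule component_self)
  then have "\<Z> \<noteq> {}" using thin_part[of x] unfolding \<Z>_def by auto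
  moreover have finS: "finite S" using SV finite_V by (auto intro: finite_subset)
  then have "finite \<Z>" unfolding \<Z>_def by (auto intro: finite_subset[of _ "Pow S"])
  ultimately obtain Z where "Z \<in> \<Z>" and max: "\<And>Z'. Z' \<in> \<Z> \<Longrightarrow> Z \<subseteq> Z' \<Longrightarrow> Z = Z'"
    using finite_has_maximal[of \<Z>] by auto
  then have Z: "Z \<subseteq> S" "connected_set Z" "card (edge_cut G Z) \<le> 2" "x \<in> Z" unfolding \<Z>_def by auto
  have "S \<subseteq> Z"
  proof (rule ccontr)
    assume "\<not> S \<subseteq> Z"
    then obtain y where y: "y \<in> S" "y \<notin> Z" by auto
    have "connected_set S" unfolding S_def by (rule component_connected)
    then obtain e p q where e: "e \<in> E" "ends G e = {p, q}" "p \<in> S" "q \<in> S" "p \<in> Z" "q \<notin> Z"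
      using connected_setE[OF _ \<open>x \<in> S\<close> Z(4) y] by metis
    obtain Z' where Z': "Z' \<subseteq> S" "connected_set Z'" "card (edge_cut G Z') \<le> 2" "q \<in> Z'"
      using thin_part[OF e(4)] by auto
    have eZ: "e \<in> edge_cut G Z" "e \<notin> edge_cut G (Z \<union> Z')"
      using cut_pair_iff[OF e(1,2)] e Z' by auto
    \<comment> \<open>The cut of \<open>Z\<close> loses \<open>e\<close> in the union. That of
      \<open>Z'\<close> loses \<open>e\<close> as well if \<open>p \<notin> Z'\<close>; otherwise,
      unless \<open>Z \<subseteq> Z'\<close>, it loses an edge \<open>f\<close> inside the connected
      set \<open>Z\<close>.\<close>
    have "card (edge_cut G (Z \<union> Z')) \<le> 2"
    proof (cases "p \<in> Z'")
      case False
      then have "e \<in> edge_cut G Z'" using cut_pair_iff[OF e(1,2)] Z' by auto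
      then show ?thesis using card_cut_union[OF Z(3) Z'(3) eZ] eZ by auto
    next
      case p: True
      show ?thesis
      proof (cases "Z \<subseteq> Z'")
        case True
        then show ?thesis using Z'(3) by (simp add: Un_absorb1)
      next
        case False
        then obtain r where r: "r \<in> Z" "r \<notin> Z'" by auto
        obtain f a b where f: "f \<in> E" "ends G f = {a, b}" "a \<in> Z" "b \<in> Z" "a \<in> Z'" "b \<notin> Z'"
          using connected_setE[OF Z(2) e(5) p r] by metis
        then have "f \<in> edge_cut G Z'" "f \<notin> edge_cut G (Z \<union> Z')"
          using cut_pair_iff[OF f(1,2)] by auto
        then show ?thesis using card_cut_union[OF Z(3) Z'(3) eZ] by auto
      qed
    qed
    moreover have "connected_set (Z \<union> Z')"
      by (rule connected_union_edge[OF Z(2) Z'(2) e(1,2,5) Z'(4)])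
    ultimately have "Z \<union> Z' \<in> \<Z>" using Z Z' unfolding \<Z>_def by auto
    then have "Z = Z \<union> Z'" using max[of "Z \<union> Z'"] by auto
    then show False using Z'(4) e(6) by auto
  qed
  then have "S = Z" using Z(1) by auto
  then show ?thesis using Z(3) unfolding S_def by simp
qed

end

section \<open>The 3-edge-connected class selected by a bramble\<close>

locale bramble = cost_graph G k for G :: "('v, 'e) mgraph" and k +
  fixes B :: "'v set set"
  assumes bramble_meet: "P \<in> B \<Longrightarrow> Q \<in> B \<Longrightarrow> P \<inter> Q \<noteq> {}"
    and bramble_subset: "P \<in> B \<Longrightarrow> P \<subseteq> V"
    and bramble_part: "X \<union> \<Union>\<Pi> = V \<Longrightarrow> X \<inter> \<Union>\<Pi> = {} \<Longrightarrow> pdisjoint \<Pi> \<Longrightarrow> card X \<le> k \<Longrightarrow>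
       card (bold_cuts \<Pi>) \<le> k \<Longrightarrow> \<exists>Q\<in>\<Pi>. Q \<in> B"
begin

text \<open>The star with empty bag and branches \<open>V - S\<close>, \<open>S \<inter> D\<close>,
  \<open>S - D\<close> costs nothing, so a branch is in \<open>B\<close>; the first misses
  \<open>S\<close> and the last misses \<open>D\<close>.\<close>

lemma bramble_thin_split:
  assumes "S \<in> B" "D \<in> B" "card (edge_cut G S) \<le> 2"
    "card (edge_cut G (S \<inter> D)) \<le> 2" "card (edge_cut G (S - D)) \<le> 2"
  shows "S \<inter> D \<in> B"
proof -
  have SV: "S \<subseteq> V" using bramble_subset[OF assms(1)] .
  let ?P = "{V - S, S \<inter> D, S - D}"
  have "card (edge_cut G (V - S)) \<le> 2" using assms(3) by (simp add: cut_compl)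
  then have "\<forall>Q\<in>?P. \<not> 3 \<le> card (edge_cut G Q)" using assms(4,5) by auto
  then have "bold_cuts ?P = {}" unfolding bold_cuts_def by blast
  moreover have "pdisjoint ?P" unfolding pdisjoint_def by auto
  moreover have "\<Union>?P = V" using SV by auto
  ultimately have "\<exists>Q\<in>?P. Q \<in> B" using bramble_part[of "{}" ?P] by auto
  moreover have "V - S \<notin> B" using bramble_meet[OF _ assms(1), of "V - S"] by auto
  moreover have "S - D \<notin> B" using bramble_meet[OF _ assms(2), of "S - D"] by auto
  ultimately show ?thesis by auto
qed

text \<open>The sets \<open>K\<close> are the unions of components of \<open>V - S\<close>; the
  condition says, in terms of cuts, that at most one such component is attached to
  \<open>S\<close>.\<close>

definition tight :: "'v set \<Rightarrow> bool" where
  "tight S \<longleftrightarrow> S \<in> B \<and> card (edge_cut G S) \<le> 2 \<and>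
     (\<forall>K. K \<subseteq> V - S \<longrightarrow> edge_cut G K \<subseteq> edge_cut G S \<longrightarrow> edge_cut G K = {} \<or> edge_cut G K = edge_cut G S)"

text \<open>Every edge leaving the component ends in \<open>cls u\<close>. A set \<open>K\<close> as
  in \<open>tight\<close> has a thin cut, so it contains all of these outer ends or none.\<close>

lemma component_tight:
  assumes u: "u \<in> V" and x: "x \<in> V - cls u" and B: "component (V - cls u) x \<in> B"
  shows "tight (component (V - cls u) x)"
    and "e \<in> edge_cut G (component (V - cls u) x) \<Longrightarrow> ends G e = {p, q} \<Longrightarrow> p \<in> component (V - cls u) x \<Longrightarrow> q \<in> cls u"
proof -
  define S where "S = component (V - cls u) x"
  have thin: "card (edge_cut G S) \<le> 2" unfolding S_def by (rule component_thin[OF u x])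
  have SV: "S \<subseteq> V - cls u" using component_subset[OF x] by (simp add: S_def)
  have cutS: "q \<in> cls u" if "e \<in> E" "ends G e = {p, q}" "p \<in> S" "q \<notin> S" for e p q
    using component_step[OF _ x, of p e q] that ends_subset[of e] unfolding S_def by auto
  have "edge_cut G K = {} \<or> edge_cut G K = edge_cut G S"
    if K: "K \<subseteq> V - S" "edge_cut G K \<subseteq> edge_cut G S" for K
  proof -
    have Kthin: "card (edge_cut G K) \<le> 2" using card_mono[OF finite_cut K(2)] thin by simp
    show ?thesis
    proof (cases "u \<in> K")
      case True
      have CK: "c \<in> K" if "c \<in> cls u" for c
        using cls_thin[OF Kthin that cls_self[OF u]] True by simp
      have "edge_cut G S \<subseteq> edge_cut G K"
      proof
        fix e assume "e \<in> edge_cut G S"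
        then obtain p q where e: "e \<in> E" "ends G e = {p, q}" "p \<in> S" "q \<notin> S" by (elim cutE)
        then show "e \<in> edge_cut G K"
          using cutS[OF e] CK[of q] K(1) cut_pair_iff[OF e(1,2), of K] by auto
      qed
      then show ?thesis using K(2) by auto
    next
      case False
      have CK: "c \<notin> K" if "c \<in> cls u" for c
        using cls_thin[OF Kthin that cls_self[OF u]] False by simp
      have "e \<notin> edge_cut G K" for e
      proof
        assume eK: "e \<in> edge_cut G K"
        then have "e \<in> edge_cut G S" using K(2) by auto
        then obtain p q where e: "e \<in> E" "ends G e = {p, q}" "p \<in> S" "q \<notin> S" by (elim cutE)
        then show False
          using cutS[OF e] CK[of q] K(1) cut_pair_iff[OF e(1,2), of K] eK by auto
      qed
      then show ?thesis by auto
    qed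
  qed
  then show "tight (component (V - cls u) x)" using thin B unfolding tight_def S_def by auto
  show "e \<in> edge_cut G (component (V - cls u) x) \<Longrightarrow> ends G e = {p, q} \<Longrightarrow> p \<in> component (V - cls u) x \<Longrightarrow> q \<in> cls u"
    using cutS[of e p q] cut_pair_iff[of e p q S] cut_subset[of G S] unfolding S_def by auto
qed

text \<open>A smallest tight set \<open>S\<close> could be shrunk by intersecting it with the component \<open>D\<close> in the bramble
  of the complement of the class of an end of a cut edge of \<open>S\<close>.\<close>

lemma bramble_class_exists:
  assumes "V \<noteq> {}"
  shows "\<exists>u\<in>V. \<forall>x\<in>V - cls u. component (V - cls u) x \<notin> B"
proof (rule ccontr)
  assume "\<not> ?thesis"
  then have branch: "\<exists>x\<in>V - cls u. component (V - cls u) x \<in> B" if "u \<in> V" for u using that by auto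
  have "\<exists>S. tight S" using assms branch component_tight(1) by blast
  then obtain S where S: "tight S" and min: "\<And>S'. tight S' \<Longrightarrow> card S \<le> card S'"
    using ex_has_least_nat[of tight _ card] by metis
  have SB: "S \<in> B" and Sthin: "card (edge_cut G S) \<le> 2" and
    Stight: "\<And>K. K \<subseteq> V - S \<Longrightarrow> edge_cut G K \<subseteq> edge_cut G S \<Longrightarrow> edge_cut G K = {} \<or> edge_cut G K = edge_cut G S"
    using S unfolding tight_def by auto
  have SV: "S \<subseteq> V" using bramble_subset[OF SB] .
  have finS: "finite S" using SV finite_V by (auto intro: finite_subset)
  have "S \<noteq> {}" using bramble_meet[OF SB SB] by auto
  \<comment> \<open>The class used for shrinking is that of an inner end of a cut edge, so that this
    edge has an end outside \<open>D\<close>.\<close>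
  have "\<exists>s\<in>S. edge_cut G S = {} \<or> (\<exists>e\<in>edge_cut G S. s \<in> ends G e)"
  proof (cases "edge_cut G S = {}")
    case True
    then show ?thesis using \<open>S \<noteq> {}\<close> by auto
  next
    case False
    then obtain e where "e \<in> edge_cut G S" by auto
    then show ?thesis unfolding edge_cut_def by auto
  qed
  then obtain s1 where s1: "s1 \<in> S" "edge_cut G S = {} \<or> (\<exists>e\<in>edge_cut G S. s1 \<in> ends G e)" by auto
  have s1V: "s1 \<in> V" using s1 SV by auto
  let ?C = "cls s1"
  have CS: "c \<in> S" if "c \<in> ?C" for c using cls_thin[OF Sthin that cls_self[OF s1V]] s1 by simp
  obtain x where x: "x \<in> V - ?C" "component (V - ?C) x \<in> B" using branch[OF s1V] by auto
  define D where "D = component (V - ?C) x"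
  have Dt: "tight D" and Dcut: "\<And>e p q. e \<in> edge_cut G D \<Longrightarrow> ends G e = {p, q} \<Longrightarrow> p \<in> D \<Longrightarrow> q \<in> ?C"
    using component_tight[OF s1V x] unfolding D_def by auto
  have DB: "D \<in> B" and Dthin: "card (edge_cut G D) \<le> 2" using Dt unfolding tight_def by auto
  have DC: "D \<subseteq> V - ?C" using component_subset[OF x(1)] by (simp add: D_def)
  have s1D: "s1 \<notin> D" using DC cls_self[OF s1V] by auto
  \<comment> \<open>By minimality of \<open>S\<close>, the connected set \<open>D\<close> sticks out
    of \<open>S\<close>, so a cut edge \<open>e2\<close> of \<open>S\<close> lies inside
    \<open>D\<close>. It differs from the edge \<open>e1\<close> at \<open>s1 \<notin> D\<close>,
    and together they exhaust the cut of \<open>S\<close>.\<close>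
  have "\<not> D \<subseteq> S"
  proof
    assume "D \<subseteq> S"
    then have "D \<subset> S" using s1D s1 by auto
    then have "card D < card S" using finS by (rule psubset_card_mono[rotated])
    then show False using min[OF Dt] by simp
  qed
  then obtain d where d: "d \<in> D" "d \<notin> S" by auto
  obtain d' where d': "d' \<in> D" "d' \<in> S" using bramble_meet[OF DB SB] by auto
  have "connected_set D" unfolding D_def by (rule component_connected)
  then obtain e2 s2 o2 where e2: "e2 \<in> E" "ends G e2 = {s2, o2}" "s2 \<in> D" "o2 \<in> D" "s2 \<in> S" "o2 \<notin> S"
    using connected_setE[OF _ d' d] by metis
  have e2S: "e2 \<in> edge_cut G S" using cutI[OF e2(1,2,5,6)] .
  then obtain e1 where e1S: "e1 \<in> edge_cut G S" "s1 \<in> ends G e1" using s1 by auto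
  have e1E: "e1 \<in> E" using e1S cut_subset[of G S] by auto
  obtain o1 where e1: "ends G e1 = {s1, o1}" using ends_other[OF e1E e1S(2)] by metis
  have o1S: "o1 \<notin> S" using e1S(1) cut_pair_iff[OF e1E e1] s1 by auto
  have "e1 \<noteq> e2" using e1 e2 s1D by auto
  then have cutS: "edge_cut G S = {e1, e2}"
    using e1S(1) e2S Sthin finite_cut by (intro card_seteq[symmetric]) auto
  \<comment> \<open>Edges leaving \<open>D\<close> end in the class, which lies in \<open>S\<close>.
    Since \<open>D - S\<close> is attached by \<open>e2\<close>, tightness attaches it by
    \<open>e1\<close> too; hence \<open>o1 \<in> D\<close>, and \<open>e1\<close> is a cut edge of
    \<open>D\<close>.\<close>
  have "edge_cut G (D - S) \<subseteq> edge_cut G S"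
  proof
    fix e assume "e \<in> edge_cut G (D - S)"
    then obtain p q where e: "e \<in> E" "ends G e = {p, q}" "p \<in> D - S" "q \<notin> D - S" by (elim cutE)
    have "q \<in> S"
    proof (rule ccontr)
      assume "q \<notin> S"
      then have "e \<in> edge_cut G D" using e cut_pair_iff[OF e(1,2)] by auto
      then show False using Dcut[OF _ e(2)] e(3) CS \<open>q \<notin> S\<close> by auto
    qed
    then show "e \<in> edge_cut G S" using e cut_pair_iff[OF e(1,2)] by auto
  qed
  moreover have "e2 \<in> edge_cut G (D - S)" using e2 cut_pair_iff[OF e2(1,2)] by auto
  moreover have "D - S \<subseteq> V - S" using DC by auto
  ultimately have "edge_cut G (D - S) = edge_cut G S" using Stight[of "D - S"] by auto
  then have "e1 \<in> edge_cut G (D - S)" using e1S by auto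
  then have o1D: "o1 \<in> D" using cut_pair_iff[OF e1E e1] s1 by auto
  then have e1D: "e1 \<in> edge_cut G D" using cut_pair_iff[OF e1E e1] s1D by auto
  have "edge_cut G (S - D) \<subseteq> edge_cut G D"
  proof
    fix e assume "e \<in> edge_cut G (S - D)"
    then obtain p q where e: "e \<in> E" "ends G e = {p, q}" "p \<in> S - D" "q \<notin> S - D" by (elim cutE)
    show "e \<in> edge_cut G D"
    proof (cases "q \<in> S")
      case True
      then show ?thesis using e cut_pair_iff[OF e(1,2)] by auto
    next
      case False
      then have "e \<in> {e1, e2}" using e cut_pair_iff[OF e(1,2), of S] cutS by auto
      moreover have "e \<noteq> e2" using e e2 by (auto simp: doubleton_eq_iff)
      ultimately show ?thesis using e1D by auto
    qed
  qed
  then have thin1: "card (edge_cut G (S - D)) \<le> 2" using card_mono[OF finite_cut] Dthin by (meson le_trans)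
  have inter_cut: "e = e2 \<or> (e \<in> edge_cut G D \<and> e \<noteq> e1)" if e: "e \<in> edge_cut G (S \<inter> D)" for e
  proof -
    obtain p q where pq: "e \<in> E" "ends G e = {p, q}" "p \<in> S \<inter> D" "q \<notin> S \<inter> D" using e by (elim cutE)
    have ne: "e \<noteq> e1" using pq(2,3) e1 s1D o1S by (auto simp: doubleton_eq_iff)
    show ?thesis
    proof (cases "q \<in> D")
      case True
      then have "e \<in> edge_cut G S" using pq cut_pair_iff[OF pq(1,2)] by auto
      then show ?thesis using cutS ne by auto
    next
      case False
      then show ?thesis using pq cut_pair_iff[OF pq(1,2)] ne by auto
    qed
  qed
  \<comment> \<open>Compared with the thin cut of \<open>D\<close>, the edge \<open>e1\<close> is
    lost and at most \<open>e2\<close> is gained.\<close>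
  have thin2: "card (edge_cut G (S \<inter> D)) \<le> 2"
  proof -
    have "edge_cut G (S \<inter> D) \<subseteq> insert e2 (edge_cut G D - {e1})" using inter_cut by auto
    then have "card (edge_cut G (S \<inter> D)) \<le> card (insert e2 (edge_cut G D - {e1}))"
      using finite_cut by (intro card_mono) auto
    also have "\<dots> \<le> Suc (card (edge_cut G D - {e1}))"
      using finite_cut by (intro card_insert_le_m1) auto
    also have "\<dots> \<le> 2" using card_Diff_singleton[OF e1D] Dthin by auto
    finally show ?thesis .
  qed
  have SDB: "S \<inter> D \<in> B" using bramble_thin_split[OF SB DB Sthin thin2 thin1] .
  \<comment> \<open>The outer ends of the cut edges are \<open>s2\<close>'s neighbour
    \<open>o2\<close> or vertices of the class. Tightness of \<open>S\<close>, applied to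
    \<open>K - S\<close>, puts \<open>o1\<close> and \<open>o2\<close> on the same side of
    \<open>K\<close>; the edge \<open>e1\<close> ties \<open>o1\<close> to \<open>s1\<close>, and
    the thin cut of \<open>K\<close> ties \<open>s1\<close> to its class.\<close>
  have "edge_cut G K = {} \<or> edge_cut G K = edge_cut G (S \<inter> D)"
    if K: "K \<subseteq> V - S \<inter> D" "edge_cut G K \<subseteq> edge_cut G (S \<inter> D)" for K
  proof -
    have Kthin: "card (edge_cut G K) \<le> 2" using card_mono[OF finite_cut K(2)] thin2 by simp
    have "edge_cut G (K - S) \<subseteq> edge_cut G S"
    proof
      fix e assume "e \<in> edge_cut G (K - S)"
      then obtain p q where e: "e \<in> E" "ends G e = {p, q}" "p \<in> K - S" "q \<notin> K - S" by (elim cutE)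
      have "q \<in> S"
      proof (rule ccontr)
        assume "q \<notin> S"
        then have "e \<in> edge_cut G K" using e cut_pair_iff[OF e(1,2)] by auto
        then have "e \<in> edge_cut G (S \<inter> D)" using K(2) by auto
        then show False using e cut_pair_iff[OF e(1,2)] \<open>q \<notin> S\<close> by auto
      qed
      then show "e \<in> edge_cut G S" using e cut_pair_iff[OF e(1,2)] by auto
    qed
    moreover have "K - S \<subseteq> V - S" using K by auto
    ultimately have "edge_cut G (K - S) = {} \<or> edge_cut G (K - S) = edge_cut G S" using Stight by auto
    then have "e1 \<in> edge_cut G (K - S) \<longleftrightarrow> e2 \<in> edge_cut G (K - S)" using e1S e2S by auto
    then have o12: "o1 \<in> K \<longleftrightarrow> o2 \<in> K"
      using cut_pair_iff[OF e1E e1] cut_pair_iff[OF e2(1,2)] s1 o1S e2 by auto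
    have "e1 \<notin> edge_cut G K" using K(2) inter_cut[of e1] \<open>e1 \<noteq> e2\<close> by auto
    then have s1o1: "s1 \<in> K \<longleftrightarrow> o1 \<in> K" using cut_pair_iff[OF e1E e1] by auto
    have s2K: "s2 \<notin> K" using K(1) e2 by auto
    have CK: "c \<in> K \<longleftrightarrow> s1 \<in> K" if "c \<in> ?C" for c using cls_thin[OF Kthin that cls_self[OF s1V]] .
    have iff: "e \<in> edge_cut G K \<longleftrightarrow> s1 \<in> K" if e: "e \<in> edge_cut G (S \<inter> D)" for e
    proof (cases "e = e2")
      case True
      then show ?thesis using cut_pair_iff[OF e2(1,2), of K] s2K o12 s1o1 by auto
    next
      case False
      then have eD: "e \<in> edge_cut G D" using inter_cut[OF e] by auto
      obtain p q where pq: "e \<in> E" "ends G e = {p, q}" "p \<in> S \<inter> D" "q \<notin> S \<inter> D" using e by (elim cutE)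
      have "q \<in> ?C" using Dcut[OF eD pq(2)] pq(3) by auto
      then show ?thesis using cut_pair_iff[OF pq(1,2), of K] CK[of q] pq(3) K(1) by auto
    qed
    show ?thesis
    proof (cases "s1 \<in> K")
      case True
      then show ?thesis using iff K(2) by auto
    next
      case False
      then have "edge_cut G K = {}" using iff K(2) by auto
      then show ?thesis by simp
    qed
  qed
  then have "tight (S \<inter> D)" using SDB thin2 unfolding tight_def by auto
  then have "card S \<le> card (S \<inter> D)" by (rule min)
  moreover have "S \<inter> D \<subset> S" using s1 s1D by auto
  then have "card (S \<inter> D) < card S" using finS by (rule psubset_card_mono[rotated])
  ultimately show False by simp
qed

end

subsection \<open>The escape strategy of the robber\<close>

context fin_graph
begin

text \<open>The anchor of a component of \<open>V - cls u\<close> does not depend on the cop position, so the preimages of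
  two sets under \<open>retract u\<close> meet only if the sets do.\<close>

definition anchor :: "'v \<Rightarrow> 'v set \<Rightarrow> 'v" where
  "anchor u S = (if edge_cut G S = {} then u else (SOME c. c \<in> cls u \<and> (\<exists>e\<in>edge_cut G S. c \<in> ends G e)))"

definition retract :: "'v \<Rightarrow> 'v \<Rightarrow> 'v" where
  "retract u v = (if v \<in> cls u then v else anchor u (component (V - cls u) v))"

lemma component_cut_outer:
  assumes "x \<in> V - cls u" "e \<in> E" "ends G e = {p, q}"
    "p \<in> component (V - cls u) x" "q \<notin> component (V - cls u) x"
  shows "q \<in> cls u"
  using component_step[OF assms(4,1,2,3)] assms(2,3,5) ends_subset[of e] by auto

lemma anchor_edge:
  assumes x: "x \<in> V - cls u" and S: "S = component (V - cls u) x" and ne: "edge_cut G S \<noteq> {}"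
  shows "\<exists>e s. e \<in> edge_cut G S \<and> ends G e = {s, anchor u S} \<and> s \<in> S \<and> anchor u S \<in> cls u"
proof -
  obtain e where e: "e \<in> edge_cut G S" using ne by auto
  then obtain p q where pq: "e \<in> E" "ends G e = {p, q}" "p \<in> S" "q \<notin> S" by (elim cutE)
  have "q \<in> cls u" using component_cut_outer[OF x pq(1,2)] pq(3,4) S by auto
  then have "q \<in> cls u \<and> (\<exists>e\<in>edge_cut G S. q \<in> ends G e)" using e pq by auto
  from someI[of "\<lambda>c. c \<in> cls u \<and> (\<exists>e\<in>edge_cut G S. c \<in> ends G e)", OF this]
  have a: "anchor u S \<in> cls u" "\<exists>e\<in>edge_cut G S. anchor u S \<in> ends G e"
    using ne unfolding anchor_def by auto
  then obtain e' where e': "e' \<in> edge_cut G S" "anchor u S \<in> ends G e'" by auto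
  then obtain p' q' where pq': "ends G e' = {p', q'}" "p' \<in> S" "q' \<notin> S" by (elim cutE)
  have "anchor u S \<notin> S" using a(1) component_subset[OF x] S by auto
  then have "anchor u S = q'" using e' pq' by auto
  then show ?thesis using e' pq' a by auto
qed

lemma retract_in_class:
  assumes "u \<in> V" "v \<in> V"
  shows "retract u v \<in> cls u"
proof (cases "v \<in> cls u")
  case False
  show ?thesis
  proof (cases "edge_cut G (component (V - cls u) v) = {}")
    case True
    then show ?thesis using False cls_self[OF assms(1)] by (simp add: retract_def anchor_def)
  next
    case ne: False
    then show ?thesis using anchor_edge[OF _ refl ne] False assms by (auto simp: retract_def)
  qed
qed (simp add: retract_def)

lemma retract_component:
  assumes "x \<in> V - cls u" "y \<in> component (V - cls u) x"
  shows "retract u y = anchor u (component (V - cls u) x)"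
  using assms component_eq[OF assms(2)] component_subset[OF assms(1)] by (auto simp: retract_def)

text \<open>An edge whose ends retract to different components of \<open>G - F\<close> is charged to an edge of \<open>F\<close>: to itself if
  both ends lie in the class, and otherwise to an edge meeting its component of \<open>V - cls u\<close>. Such a
  component is charged once only, since one of its at most two cut edges leads to the anchor.\<close>

definition separated_edges :: "'v \<Rightarrow> 'e set \<Rightarrow> 'e set" where
  "separated_edges u F =
     {e \<in> E. \<exists>p q. ends G e = {p, q} \<and> (retract u p, retract u q) \<notin> (adj G F)\<^sup>*}"

lemma card_separated_edges:
  assumes u: "u \<in> V" and F: "F \<subseteq> E"
  shows "card (separated_edges u F) \<le> card F"
proof -
  let ?X = "separated_edges u F"
  let ?W = "V - cls u"
  define charge where "charge e f \<longleftrightarrow> (f = e \<and> ends G e \<subseteq> cls u) \<or>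
    (\<exists>x\<in>?W. e \<in> edge_cut G (component ?W x) \<and> ends G f \<inter> component ?W x \<noteq> {})" for e f
  have ex: "\<exists>f. f \<in> F \<and> charge e f" if eX: "e \<in> ?X" for e
  proof -
    obtain p q where e: "e \<in> E" "ends G e = {p, q}" and sep: "(retract u p, retract u q) \<notin> (adj G F)\<^sup>*"
      using eX unfolding separated_edges_def by auto
    have mixed: ?thesis if e': "ends G e = {p, q}" "(retract u p, retract u q) \<notin> (adj G F)\<^sup>*" "p \<in> ?W" for p q
    proof -
      let ?S = "component ?W p"
      have "q \<notin> ?S"
      proof
        assume "q \<in> ?S"
        then have "retract u p = retract u q" using retract_component[OF e'(3)] component_self[of p ?W] by metis
        then show False using e'(2) by simp
      qed
      then have q: "q \<in> cls u" using component_cut_outer[OF e'(3) e(1) e'(1) component_self] by auto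
      have eS: "e \<in> edge_cut G ?S" using cutI[OF e(1) e'(1) component_self \<open>q \<notin> ?S\<close>] .
      then obtain e0 s where e0: "e0 \<in> edge_cut G ?S" "ends G e0 = {s, anchor u ?S}" "s \<in> ?S"
        using anchor_edge[OF e'(3) refl] by blast
      have e0E: "e0 \<in> E" using e0 cut_subset[of G ?S] by auto
      \<comment> \<open>Otherwise \<open>F\<close> leaves a connection from \<open>q\<close> along
        \<open>e\<close>, through the component and along \<open>e0\<close> to the anchor, so
        \<open>e\<close> would not be separated.\<close>
      have "\<exists>f\<in>F. ends G f \<inter> ?S \<noteq> {}"
      proof (rule ccontr)
        assume no: "\<not> ?thesis"
        let ?Z = "{z. (anchor u ?S, z) \<in> (adj G F)\<^sup>*}"
        have step: "z' \<in> ?Z" if "z \<in> ?Z" "f \<in> E" "ends G f = {z, z'}" "f \<notin> F" for z z' f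
          using that unfolding adj_def by (auto intro: rtrancl_into_rtrancl)
        have "e0 \<notin> F" using no e0 by auto
        then have s: "s \<in> ?Z" using step[of "anchor u ?S" e0 s] e0E e0(2) by (simp add: insert_commute)
        have p: "p \<in> ?Z"
        proof (rule ccontr)
          assume "p \<notin> ?Z"
          then obtain f a b where f: "f \<in> E" "ends G f = {a, b}" "a \<in> ?S" "b \<in> ?S" "a \<in> ?Z" "b \<notin> ?Z"
            using connected_setE[OF component_connected e0(3) s component_self] by metis
          then have "f \<notin> F" using no by auto
          then show False using step[OF f(5,1,2)] f(6) by auto
        qed
        have "e \<notin> F" using no e'(1) component_self[of p ?W] by auto
        then have "q \<in> ?Z" using step[OF p e(1) e'(1)] by auto
        moreover have "retract u p = anchor u ?S" using retract_component[OF e'(3) component_self] .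
        moreover have "retract u q = q" using q by (simp add: retract_def)
        ultimately show False using e'(2) by simp
      qed
      then show ?thesis using eS e'(3) unfolding charge_def by auto
    qed
    show ?thesis
    proof (cases "p \<in> cls u \<and> q \<in> cls u")
      case True
      then have "e \<in> F" using sep e unfolding retract_def adj_def by auto
      then show ?thesis using True e unfolding charge_def by auto
    next
      case False
      have pqV: "p \<in> V" "q \<in> V" using ends_subset[OF e(1)] e(2) by auto
      have "(retract u q, retract u p) \<notin> (adj G F)\<^sup>*" using sep adj_rtrancl_sym[of "retract u q"] by auto
      moreover have "ends G e = {q, p}" using e(2) by auto
      ultimately show ?thesis using mixed[of p q] mixed[of q p] e(2) sep False pqV by auto
    qed
  qed
  then have "\<forall>e\<in>?X. \<exists>f. f \<in> F \<and> charge e f" by blast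
  from bchoice[OF this] obtain g where g: "\<forall>e\<in>?X. g e \<in> F \<and> charge e (g e)" by (elim exE)
  \<comment> \<open>An edge of \<open>F\<close> inside the class is charged only by itself. Any
    other one meets a single component; two edges charged to it and the anchor edge
    \<open>e0\<close>, which is not separated, would be three edges of a thin cut.\<close>
  have "inj_on g ?X"
  proof (rule inj_onI, rule ccontr)
    fix e e' assume eX: "e \<in> ?X" and eX': "e' \<in> ?X" and eq: "g e = g e'" and ne: "e \<noteq> e'"
    have disj: "ends G f \<inter> component ?W x = {}" if "x \<in> ?W" "ends G f \<subseteq> cls u" for f x
      using component_subset[OF that(1)] that(2) by auto
    have c: "charge e (g e)" "charge e' (g e)" using g eX eX' eq by auto
    have key: "f = d" if ch: "charge d f" "ends G f \<subseteq> cls u" for d f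
    proof (rule ccontr)
      assume "f \<noteq> d"
      then obtain x where "x \<in> ?W" "ends G f \<inter> component ?W x \<noteq> {}" using ch(1) unfolding charge_def by auto
      then show False using disj[of x f] ch(2) by auto
    qed
    have out: "\<not> ends G (g e) \<subseteq> cls u" using key[OF c(1)] key[OF c(2)] ne by auto
    obtain x where x: "x \<in> ?W" "e \<in> edge_cut G (component ?W x)" "ends G (g e) \<inter> component ?W x \<noteq> {}"
      using c(1) out unfolding charge_def by auto
    obtain x' where x': "x' \<in> ?W" "e' \<in> edge_cut G (component ?W x')" "ends G (g e) \<inter> component ?W x' \<noteq> {}"
      using c(2) out unfolding charge_def by auto
    obtain a where a: "a \<in> ends G (g e)" "a \<in> component ?W x" using x by auto
    obtain b where b: "b \<in> ends G (g e)" "b \<in> component ?W x'" using x' by auto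
    have gE: "g e \<in> E" using g eX F by auto
    have aW: "a \<in> ?W" "b \<in> ?W" using a(2) b(2) component_subset[OF x(1)] component_subset[OF x'(1)] by auto
    have "component ?W x = component ?W x'"
    proof (cases "a = b")
      case True
      then show ?thesis using a b component_eq by metis
    next
      case False
      obtain c where "ends G (g e) = {a, c}" using ends_other[OF gE a(1)] .
      then have "ends G (g e) = {a, b}" using b False by auto
      then have "b \<in> component ?W x" using component_step[OF a(2) x(1) gE _ aW(2)] by auto
      then show ?thesis using b component_eq by metis
    qed
    then have x'S: "e' \<in> edge_cut G (component ?W x)" using x' by simp
    let ?S = "component ?W x"
    obtain e0 s where e0: "e0 \<in> edge_cut G ?S" "ends G e0 = {s, anchor u ?S}" "s \<in> ?S" "anchor u ?S \<in> cls u"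
      using anchor_edge[OF x(1) refl] x(2) by blast
    have "retract u s = anchor u ?S" using retract_component[OF x(1) e0(3)] .
    moreover have "retract u (anchor u ?S) = anchor u ?S" using e0(4) by (simp add: retract_def)
    ultimately have "e0 \<notin> ?X" using e0(2) unfolding separated_edges_def by (auto simp: doubleton_eq_iff)
    then have "e \<noteq> e0" "e' \<noteq> e0" using eX eX' by auto
    then have "card {e, e', e0} = 3" using ne by simp
    moreover have "card {e, e', e0} \<le> card (edge_cut G ?S)"
      using x(2) x'S e0(1) finite_cut by (intro card_mono) auto
    ultimately show False using component_thin[OF u x(1)] by simp
  qed
  then show ?thesis using g finite_subset[OF F finite_E] by (intro card_inj_on_le[of g]) auto
qed

end

context bramble
begin

definition fibre :: "'v \<Rightarrow> 'v set \<Rightarrow> 'v set" where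
  "fibre u Y = {v \<in> V. retract u v \<in> Y}"

text \<open>Two stars are offered to the bramble. In the first, with empty bag, the branches are the
  fibres of the parts into which \<open>F\<close> divides the class, which selects a fibre
  \<open>Q\<close>. If its part had at most \<open>k\<close> vertices, a second star with that part
  as bag would have no branch in \<open>B\<close>.\<close>

lemma haven:
  assumes u: "u \<in> V" and nB: "\<And>x. x \<in> V - cls u \<Longrightarrow> component (V - cls u) x \<notin> B"
    and F: "F \<subseteq> E" "card F \<le> k"
  shows "\<exists>Y\<subseteq>cls u. fibre u Y \<in> B \<and> k < card Y \<and> (\<forall>x\<in>Y. \<forall>y\<in>Y. (x, y) \<in> (adj G F)\<^sup>*)"
proof -
  let ?W = "V - cls u"
  define Y where "Y c = {y \<in> cls u. (c, y) \<in> (adj G F)\<^sup>*}" for c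
  define \<Pi> where "\<Pi> = (\<lambda>c. fibre u (Y c)) ` cls u"
  have Y_conn: "(x, y) \<in> (adj G F)\<^sup>*" if "x \<in> Y c" "y \<in> Y c" for x y c
    using that adj_rtrancl_sym[of c x] unfolding Y_def by (auto intro: rtrancl_trans)
  have Y_eq: "Y c = Y d" if "x \<in> Y c" "x \<in> Y d" for x c d
  proof -
    have cd: "(c, x) \<in> (adj G F)\<^sup>*" "(d, x) \<in> (adj G F)\<^sup>*" using that unfolding Y_def by auto
    have "(c, d) \<in> (adj G F)\<^sup>*" using rtrancl_trans[OF cd(1) adj_rtrancl_sym[OF cd(2)]] .
    moreover have "(d, c) \<in> (adj G F)\<^sup>*" using rtrancl_trans[OF cd(2) adj_rtrancl_sym[OF cd(1)]] .
    ultimately show ?thesis unfolding Y_def by (auto intro: rtrancl_trans)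
  qed
  have cut_sep: "edge_cut G (fibre u (Y c)) \<subseteq> separated_edges u F" if "c \<in> cls u" for c
  proof
    fix e assume "e \<in> edge_cut G (fibre u (Y c))"
    then obtain p q where e: "e \<in> E" "ends G e = {p, q}" "p \<in> fibre u (Y c)" "q \<notin> fibre u (Y c)" "q \<in> V"
      by (elim cutE)
    have "retract u q \<notin> Y c" "retract u p \<in> Y c" using e(3-5) unfolding fibre_def by auto
    moreover have "retract u q \<in> cls u" using retract_in_class[OF u e(5)] .
    ultimately have "(retract u p, retract u q) \<notin> (adj G F)\<^sup>*"
      unfolding Y_def by (auto intro: rtrancl_trans)
    then show "e \<in> separated_edges u F" using e(1,2) unfolding separated_edges_def by auto
  qed
  \<comment> \<open>All fibres draw their cut edges from one set of at most \<open>card F\<close>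
    edges, so the union is bounded and not merely each cut.\<close>
  have "bold_cuts \<Pi> \<subseteq> separated_edges u F"
    using cut_sep unfolding bold_cuts_def \<Pi>_def by auto
  moreover have "finite (separated_edges u F)"
    unfolding separated_edges_def using finite_E by auto
  ultimately have bc: "card (bold_cuts \<Pi>) \<le> k"
    using card_mono card_separated_edges[OF u F(1)] F(2) by (meson le_trans)
  have pd: "pdisjoint \<Pi>"
    unfolding pdisjoint_def
  proof (intro ballI impI)
    fix P Q assume "P \<in> \<Pi>" "Q \<in> \<Pi>" "P \<noteq> Q"
    then obtain c d where cd: "P = fibre u (Y c)" "Q = fibre u (Y d)" unfolding \<Pi>_def by (elim imageE)
    then have ne: "Y c \<noteq> Y d" using \<open>P \<noteq> Q\<close> by auto
    show "P \<inter> Q = {}"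
    proof (rule ccontr)
      assume "P \<inter> Q \<noteq> {}"
      then obtain v where "retract u v \<in> Y c" "retract u v \<in> Y d" using cd unfolding fibre_def by auto
      then show False using Y_eq ne by auto
    qed
  qed
  have "\<Union>\<Pi> = V"
  proof (intro equalityI subsetI)
    fix v assume v: "v \<in> V"
    have r: "retract u v \<in> cls u" using retract_in_class[OF u v] .
    then have "v \<in> fibre u (Y (retract u v))" using v unfolding fibre_def Y_def by auto
    then show "v \<in> \<Union>\<Pi>" using r unfolding \<Pi>_def by auto
  qed (auto simp: \<Pi>_def fibre_def)
  then obtain Q where Q: "Q \<in> \<Pi>" "Q \<in> B" using bramble_part[of "{}" \<Pi>] pd bc by auto
  then obtain c where c: "c \<in> cls u" "Q = fibre u (Y c)" unfolding \<Pi>_def by auto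
  have YC: "Y c \<subseteq> cls u" unfolding Y_def by auto
  have "k < card (Y c)"
  proof (rule ccontr)
    assume "\<not> k < card (Y c)"
    then have cY: "card (Y c) \<le> k" by simp
    \<comment> \<open>The components inside \<open>Q\<close> are thin, so the second star pays only
      for the cut of \<open>V - Q\<close>, which is that of \<open>Q\<close> and part of the first
      star's cost.\<close>
    define \<C> where "\<C> = component ?W ` (Q - cls u)"
    have QV: "Q \<subseteq> V" using bramble_subset[OF Q(2)] .
    have CQ: "component ?W x \<subseteq> Q - cls u" if x: "x \<in> Q - cls u" for x
    proof
      fix y assume y: "y \<in> component ?W x"
      have xW: "x \<in> ?W" using x QV by auto
      have "retract u y = retract u x" using retract_component[OF xW y] retract_component[OF xW component_self] by simp
      moreover have "y \<in> ?W" using y component_subset[OF xW] by auto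
      ultimately show "y \<in> Q - cls u" using x unfolding c(2) fibre_def by auto
    qed
    have UC: "\<Union>\<C> = Q - cls u"
    proof (intro equalityI subsetI)
      fix x assume "x \<in> Q - cls u"
      then show "x \<in> \<Union>\<C>" using component_self[of x ?W] unfolding \<C>_def by auto
    qed (use CQ in \<open>auto simp: \<C>_def\<close>)
    have QC: "Q \<inter> cls u = Y c"
      using YC cls_subset unfolding c(2) fibre_def by (auto simp: retract_def)
    have "pdisjoint \<C>" unfolding pdisjoint_def
    proof (intro ballI impI)
      fix P R assume "P \<in> \<C>" "R \<in> \<C>" "P \<noteq> R"
      then obtain x y where xy: "P = component ?W x" "R = component ?W y" unfolding \<C>_def by auto
      show "P \<inter> R = {}"
      proof (rule ccontr)
        assume "P \<inter> R \<noteq> {}"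
        then obtain z where "z \<in> component ?W x" "z \<in> component ?W y" using xy by auto
        then have "component ?W x = component ?W y" using component_eq[of z ?W x] component_eq[of z ?W y] by simp
        then show False using xy \<open>P \<noteq> R\<close> by simp
      qed
    qed
    then have pd': "pdisjoint (insert (V - Q) \<C>)" using UC by (intro pdisjoint_insert) auto
    have "\<not> 3 \<le> card (edge_cut G R)" if "R \<in> \<C>" for R
      using that component_thin[OF u] QV unfolding \<C>_def by fastforce
    then have "bold_cuts (insert (V - Q) \<C>) \<subseteq> bold_cuts \<Pi>"
      using Q(1) unfolding bold_cuts_def by (auto simp: cut_compl)
    then have "card (bold_cuts (insert (V - Q) \<C>)) \<le> k"
      using card_mono[OF finite_bold_cuts] bc by (meson le_trans)
    moreover have "Y c \<union> \<Union>(insert (V - Q) \<C>) = V" using UC QC QV by auto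
    moreover have "Y c \<inter> \<Union>(insert (V - Q) \<C>) = {}" using UC QC QV by auto
    ultimately have "\<exists>R\<in>insert (V - Q) \<C>. R \<in> B" using pd' cY by (intro bramble_part[of "Y c"])
    then obtain R where R: "R \<in> insert (V - Q) \<C>" "R \<in> B" by auto
    have "V - Q \<notin> B" using bramble_meet[OF _ Q(2), of "V - Q"] by auto
    moreover have "R \<notin> \<C>" using R(2) nB QV unfolding \<C>_def by auto
    ultimately show False using R by auto
  qed
  then show ?thesis using YC Q(2) c(2) Y_conn by (intro exI[of _ "Y c"]) auto
qed

text \<open>A robber who always occupies the part \<open>Y\<close> of the current cop position is
  never caught, as that part has more than \<open>k\<close> vertices.\<close>

lemma bramble_not_searchable:
  assumes "V \<noteq> {}"
  shows "\<not> searchable G k k"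
proof
  assume "searchable G k k"
  then obtain \<sigma> where \<sigma>: "\<And>h. \<sigma> h \<subseteq> E \<and> card (\<sigma> h) \<le> k"
    and win: "\<And>r. robber_play G \<sigma> r \<Longrightarrow> \<exists>i\<ge>1. caught G k (cop_position \<sigma> r i) (r i)"
    unfolding searchable_def valid_cop_strategy_def by auto
  obtain u where u: "u \<in> V" "\<And>x. x \<in> V - cls u \<Longrightarrow> component (V - cls u) x \<notin> B"
    using bramble_class_exists[OF assms] by auto
  have "\<forall>F. \<exists>Y. F \<subseteq> E \<and> card F \<le> k \<longrightarrow>
      Y \<subseteq> cls u \<and> fibre u Y \<in> B \<and> k < card Y \<and> (\<forall>x\<in>Y. \<forall>y\<in>Y. (x, y) \<in> (adj G F)\<^sup>*)"
    using haven[OF u] by auto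
  from choice[OF this] obtain Y where Y0: "\<forall>F. F \<subseteq> E \<and> card F \<le> k \<longrightarrow>
      Y F \<subseteq> cls u \<and> fibre u (Y F) \<in> B \<and> k < card (Y F) \<and> (\<forall>x\<in>Y F. \<forall>y\<in>Y F. (x, y) \<in> (adj G F)\<^sup>*)"
    by (elim exE)
  define g where "g F = (SOME y. y \<in> Y F)" for F
  \<comment> \<open>At the start the cops occupy nothing, whatever the strategy says about the empty
    history.\<close>
  define pos where "pos h = (if h = [] then {} else \<sigma> h)" for h
  have Y: "Y (pos h) \<subseteq> cls u" "fibre u (Y (pos h)) \<in> B" "k < card (Y (pos h))"
    "\<And>x y. x \<in> Y (pos h) \<Longrightarrow> y \<in> Y (pos h) \<Longrightarrow> (x, y) \<in> (adj G (pos h))\<^sup>*" for h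
    using Y0[rule_format, of "pos h"] \<sigma>[of h] unfolding pos_def by (auto split: if_splits)
  have gY: "g (pos h) \<in> Y (pos h)" for h
  proof -
    have "Y (pos h) \<noteq> {}" using Y(3)[of h] by auto
    then show ?thesis unfolding g_def by (simp add: some_in_eq)
  qed
  \<comment> \<open>Position \<open>n\<close> answers the set announced on the history of positions
    0 to \<open>n - 1\<close>, so positions and histories arise in one recursion.\<close>
  define hist where "hist = rec_nat [] (\<lambda>_ h. h @ [g (pos h)])"
  have hist: "hist 0 = []" "hist (Suc n) = hist n @ [g (pos (hist n))]" for n
    by (simp_all add: hist_def)
  define r where "r n = g (pos (hist n))" for n
  have hist_map: "hist n = map r [0..<n]" for n
    by (induction n) (auto simp: hist r_def)
  have cop: "cop_position \<sigma> r n = pos (hist n)" for n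
    unfolding cop_position_def pos_def hist_map by auto
  have rY: "r n \<in> Y (pos (hist n))" for n unfolding r_def by (rule gY)
  have rC: "r n \<in> cls u" for n using rY[of n] Y(1) by auto
  have tec: "three_edge_connected G x y" if "x \<in> cls u" "y \<in> cls u" for x y
    using that by (intro same_class_imp_three_edge_connected) (auto simp: cls_def same_class_def)
  have CV: "x \<in> V" if "x \<in> cls u" for x using that cls_subset by auto
  have play: "robber_play G \<sigma> r"
    unfolding robber_play_def robber_move_def cop
  proof (intro conjI allI)
    fix i
    let ?F = "pos (hist i)" and ?F' = "pos (hist (Suc i))"
    \<comment> \<open>The retract of a common vertex lies in both parts. It is reached while
      avoiding the old cop position and left while avoiding the new one; only edges in both
      positions block the move.\<close>
    have "fibre u (Y ?F) \<inter> fibre u (Y ?F') \<noteq> {}" using bramble_meet[OF Y(2) Y(2)] .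
    then obtain v where "retract u v \<in> Y ?F" "retract u v \<in> Y ?F'" unfolding fibre_def by auto
    then have "(r i, retract u v) \<in> (adj G ?F)\<^sup>*" "(retract u v, r (Suc i)) \<in> (adj G ?F')\<^sup>*"
      using Y(4) rY by auto
    moreover have "(adj G ?F)\<^sup>* \<subseteq> (adj G (?F \<inter> ?F'))\<^sup>*" "(adj G ?F')\<^sup>* \<subseteq> (adj G (?F \<inter> ?F'))\<^sup>*"
      by (intro rtrancl_mono adj_mono; simp)+
    ultimately have "(r i, r (Suc i)) \<in> (adj G (?F \<inter> ?F'))\<^sup>*" by (meson rtrancl_trans subsetD)
    then show "reachable_avoiding G (?F \<inter> ?F') (r i) (r (Suc i))"
      using reachable_iff[OF multigraph] CV[OF rC] by auto
  qed (use rC CV tec in auto)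
  from win[OF play] obtain i where "caught G k (pos (hist i)) (r i)" unfolding cop by auto
  then have "card {y \<in> V. three_edge_connected G (r i) y \<and> reachable_avoiding G (pos (hist i)) (r i) y} \<le> k"
    unfolding caught_def .
  moreover have "Y (pos (hist i)) \<subseteq> {y \<in> V. three_edge_connected G (r i) y \<and> reachable_avoiding G (pos (hist i)) (r i) y}"
  proof
    fix y assume y: "y \<in> Y (pos (hist i))"
    then have "y \<in> cls u" using Y(1) by auto
    then show "y \<in> {y \<in> V. three_edge_connected G (r i) y \<and> reachable_avoiding G (pos (hist i)) (r i) y}"
      using Y(4)[OF rY y] CV tec[OF rC] reachable_iff[OF multigraph] by auto
  qed
  then have "card (Y (pos (hist i))) \<le> card {y \<in> V. three_edge_connected G (r i) y \<and> reachable_avoiding G (pos (hist i)) (r i) y}"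
    using finite_V by (intro card_mono) auto
  ultimately show False using Y(3)[of "hist i"] by simp
qed

end

context cost_graph
begin

lemma searchable_imp_derivable:
  assumes "V \<noteq> {}" "searchable G k k"
  shows "derivable {} V"
proof (rule ccontr)
  assume "\<not> derivable {} V"
  then obtain B where B:
    "\<And>P Q. P \<in> B \<Longrightarrow> Q \<in> B \<Longrightarrow> P \<inter> Q \<noteq> {}"
    "\<And>P. P \<in> B \<Longrightarrow> P \<subseteq> V"
    "\<And>X \<Pi>. X \<union> \<Union>\<Pi> = V \<Longrightarrow> X \<inter> \<Union>\<Pi> = {} \<Longrightarrow> pdisjoint \<Pi> \<Longrightarrow> card X \<le> k \<Longrightarrow>
       card (bold_cuts \<Pi>) \<le> k \<Longrightarrow> \<exists>Q\<in>\<Pi>. Q \<in> B"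
    by (rule bramble_exists) blast
  interpret bramble G k B by unfold_locales (fact B)+
  show False using bramble_not_searchable assms by blast
qed

end

subsection \<open>Trees of positions\<close>

text \<open>The nodes are the sequences of child numbers leading to them from the root, encoded as natural
  numbers; an edge is named after its lower end.\<close>

definition position_tree :: "nat list set \<Rightarrow> (nat, nat) mgraph" where
  "position_tree N = \<lparr>verts = list_encode ` N, edges = list_encode ` (N - {[]}),
     ends = (\<lambda>a. {a, list_encode (butlast (list_decode a))})\<rparr>"

definition kids :: "nat list set \<Rightarrow> nat list \<Rightarrow> nat list set" where
  "kids N p = {q \<in> N. \<exists>i. q = p @ [i]}"

locale positions =
  fixes N :: "nat list set"
  assumes finite_N: "finite N" and Nil_N: "[] \<in> N" and prefix_closed: "p @ [i] \<in> N \<Longrightarrow> p \<in> N"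
begin

abbreviation "T \<equiv> position_tree N"

lemma verts_T: "verts T = list_encode ` N"
  and edges_T: "edges T = list_encode ` (N - {[]})"
  and ends_T: "ends T (list_encode p) = {list_encode p, list_encode (butlast p)}"
  by (simp_all add: position_tree_def)

lemma encode_eq: "list_encode p = list_encode q \<longleftrightarrow> p = q"
  by (metis list_encode_inverse)

lemma prefix_closed_append: "p @ w \<in> N \<Longrightarrow> p \<in> N"
proof (induction w rule: rev_induct)
  case (snoc i w)
  then have "(p @ w) @ [i] \<in> N" by simp
  then show ?case using prefix_closed snoc.IH by blast
qed simp

lemma butlast_N: "p \<in> N \<Longrightarrow> butlast p \<in> N"
  using prefix_closed_append[of "butlast p" "[last p]"] by (cases "p = []") auto

lemma T_multigraph: "multigraph T"
  unfolding multigraph_def verts_T edges_T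
proof (intro conjI ballI)
  fix a assume "a \<in> list_encode ` (N - {[]})"
  then obtain p where p: "a = list_encode p" "p \<in> N" "p \<noteq> []" by auto
  then show "ends T a \<subseteq> list_encode ` N" using butlast_N by (auto simp: ends_T)
  have "length (butlast p) < length p" using p(3) by simp
  then have "butlast p \<noteq> p" by (metis less_irrefl)
  then show "card (ends T a) = 2" using p by (simp add: ends_T encode_eq)
qed (use finite_N in auto)

lemma path_down:
  assumes "r @ w \<in> N" "\<And>w' w''. w = w' @ w'' \<Longrightarrow> w' \<noteq> [] \<Longrightarrow> list_encode (r @ w') \<notin> F"
  shows "(list_encode r, list_encode (r @ w)) \<in> (adj T F)\<^sup>*"
  using assms
proof (induction w rule: rev_induct)
  case (snoc i w)
  have "(list_encode r, list_encode (r @ w)) \<in> (adj T F)\<^sup>*"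
  proof (rule snoc.IH)
    show "r @ w \<in> N" using snoc.prems(1) prefix_closed[of "r @ w" i] by simp
    show "list_encode (r @ w') \<notin> F" if "w = w' @ w''" "w' \<noteq> []" for w' w''
      using that snoc.prems(2)[of w' "w'' @ [i]"] by simp
  qed
  moreover have "list_encode (r @ w @ [i]) \<in> edges T - F"
    using snoc.prems(1) snoc.prems(2)[of "w @ [i]" "[]"] by (auto simp: edges_T)
  moreover have "ends T (list_encode (r @ w @ [i])) = {list_encode (r @ w), list_encode (r @ w @ [i])}"
    using butlast_snoc[of "r @ w" i] by (auto simp: ends_T simp del: butlast_append butlast_snoc)
  ultimately show ?case unfolding adj_def by (auto intro: rtrancl_into_rtrancl)
qed simp

text \<open>Deleting the edge named after \<open>q\<close> detaches the extensions of
  \<open>q\<close>: every other edge joins some \<open>p \<noteq> q\<close> to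
  \<open>butlast p\<close>, and these extend \<open>q\<close> both or not at all.\<close>

lemma T_reachable_iff:
  assumes "s \<in> N" "t \<in> N" "q \<in> N" "q \<noteq> []"
  shows "reachable_avoiding T {list_encode q} (list_encode s) (list_encode t) \<longleftrightarrow>
    ((\<exists>w. s = q @ w) \<longleftrightarrow> (\<exists>w. t = q @ w))"
proof -
  let ?R = "(adj T {list_encode q})\<^sup>*"
  have iff: "reachable_avoiding T {list_encode q} (list_encode s) (list_encode t) \<longleftrightarrow>
      (list_encode s, list_encode t) \<in> ?R"
    using reachable_iff[OF T_multigraph] assms(2) by (auto simp: verts_T)
  have below: "(list_encode q, list_encode (q @ w)) \<in> ?R" if "q @ w \<in> N" for w
    by (rule path_down[OF that]) (simp add: encode_eq)
  have above: "(list_encode [], list_encode p) \<in> ?R" if "p \<in> N" "\<nexists>w. p = q @ w" for p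
    using path_down[of "[]" p "{list_encode q}"] that by (auto simp: encode_eq)
  define ext where "ext p \<longleftrightarrow> (\<exists>w. p = q @ w)" for p
  define Z where "Z = {a. ext (list_decode a) = ext s}"
  have same: "list_encode t \<in> Z" if r: "(list_encode s, list_encode t) \<in> ?R"
  proof (rule rtrancl_adj_closed[OF r])
    fix e a b assume e: "e \<in> edges T - {list_encode q}" "ends T e = {a, b}" and a: "a \<in> Z"
    obtain p where p: "e = list_encode p" "p \<noteq> []" "p \<noteq> q" using e by (auto simp: edges_T)
    have eq: "ext p = ext (butlast p)"
      unfolding ext_def
    proof
      assume "\<exists>w. p = q @ w"
      then obtain w where w: "p = q @ w" by auto
      then have "w \<noteq> []" using p by auto
      then show "\<exists>w. butlast p = q @ w" using w by (auto simp: butlast_append)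
    next
      assume "\<exists>w. butlast p = q @ w"
      then obtain w where "butlast p = q @ w" by auto
      then have "p = q @ (w @ [last p])" using append_butlast_last_id[OF p(2)] by (metis append.assoc)
      then show "\<exists>w. p = q @ w" by auto
    qed
    have "{a, b} = {list_encode p, list_encode (butlast p)}" using e p by (simp add: ends_T)
    then have "a = list_encode p \<and> b = list_encode (butlast p) \<or> b = list_encode p \<and> a = list_encode (butlast p)"
      by (auto simp: doubleton_eq_iff)
    then show "b \<in> Z" using a eq unfolding Z_def by auto
  qed (simp add: Z_def)
  show ?thesis unfolding iff
  proof
    assume "(list_encode s, list_encode t) \<in> ?R"
    from same[OF this] show "(\<exists>w. s = q @ w) \<longleftrightarrow> (\<exists>w. t = q @ w)" by (simp add: Z_def ext_def)
  next
    assume eq: "(\<exists>w. s = q @ w) \<longleftrightarrow> (\<exists>w. t = q @ w)"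
    show "(list_encode s, list_encode t) \<in> ?R"
    proof (cases "\<exists>w. s = q @ w")
      case True
      then have "(list_encode q, list_encode s) \<in> ?R" "(list_encode q, list_encode t) \<in> ?R"
        using eq below assms by auto
      then show ?thesis using rtrancl_trans[OF adj_rtrancl_sym] by metis
    next
      case False
      then have "(list_encode [], list_encode s) \<in> ?R" "(list_encode [], list_encode t) \<in> ?R"
        using eq above assms by auto
      then show ?thesis using rtrancl_trans[OF adj_rtrancl_sym] by metis
    qed
  qed
qed

text \<open>At a deepest node of a cycle both cycle edges lead to nodes that are not deeper, so both
  would be the edge named after that node.\<close>

lemma T_acyclic: "\<not> is_cycle T vs es"
proof
  assume c: "is_cycle T vs es"
  define n where "n = length vs"
  have len: "length es = n" "2 \<le> n" "set vs \<subseteq> verts T" "set es \<subseteq> edges T" "distinct es"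
    and inc: "\<And>i. i < n \<Longrightarrow> ends T (es ! i) = {vs ! i, vs ! (Suc i mod n)}"
    using c unfolding is_cycle_def n_def by auto
  define d where "d i = length (list_decode (vs ! i))" for i
  have "finite (d ` {..<n})" "d ` {..<n} \<noteq> {}" using len by (auto simp: lessThan_empty_iff)
  then have "Max (d ` {..<n}) \<in> d ` {..<n}" by (rule Max_in)
  then obtain m where m: "m < n" "d m = Max (d ` {..<n})" by auto
  have max: "d i \<le> d m" if "i < n" for i unfolding m(2) using that by (intro Max_ge) auto
  have top: "e = vs ! m" if that': "e \<in> edges T" "ends T e = {vs ! m, vs ! i}" "i < n" for e i
  proof (rule ccontr)
    assume ne: "e \<noteq> vs ! m"
    obtain p where p: "e = list_encode p" "p \<noteq> []" using that'(1) by (auto simp: edges_T)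
    have "{vs ! m, vs ! i} = {list_encode p, list_encode (butlast p)}" using that p by (simp add: ends_T)
    then have "vs ! m = list_encode (butlast p)" "vs ! i = list_encode p"
      using ne p by (auto simp: doubleton_eq_iff)
    then have "d i = length p" "d m = length p - 1" by (simp_all add: d_def)
    then show False using max[OF that(3)] p(2) by (cases p) auto
  qed
  define j where "j = (if m = 0 then n - 1 else m - 1)"
  have j: "j < n" "Suc j mod n = m" "j \<noteq> m" using m(1) len(2) unfolding j_def by auto
  have esE: "es ! i \<in> edges T" if "i < n" for i using that len nth_mem[of i es] by auto
  have "es ! m = vs ! m" using top[of "es ! m" "Suc m mod n"] inc[OF m(1)] len(2) m(1) esE[OF m(1)] by auto
  moreover have "es ! j = vs ! m"
    using top[of "es ! j" j] inc[OF j(1)] j esE[OF j(1)] by (auto simp: insert_commute)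
  ultimately show False using nth_eq_iff_index_eq[OF len(5), of m j] j m len by auto
qed

lemma T_is_tree: "is_tree T"
proof -
  have down: "(list_encode [], list_encode p) \<in> (adj T {})\<^sup>*" if "p \<in> N" for p
    using path_down[of "[]" p "{}"] that by simp
  have "reachable_avoiding T {} s t" if st: "s \<in> verts T" "t \<in> verts T" for s t
  proof -
    obtain p q where "s = list_encode p" "p \<in> N" "t = list_encode q" "q \<in> N" using st by (auto simp: verts_T)
    then show ?thesis
      using reachable_iff[OF T_multigraph] st rtrancl_trans[OF adj_rtrancl_sym[OF down[of p]] down[of q]]
      by auto
  qed
  then show ?thesis using T_multigraph T_acyclic Nil_N unfolding is_tree_def by (auto simp: verts_T)
qed

end

lemma list_compare:
  "(\<exists>w. s = q @ w) \<or> (\<exists>i w. q = s @ i # w) \<or> (\<exists>c i j w w'. q = c @ i # w \<and> s = c @ j # w' \<and> i \<noteq> j)"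
proof (induction q arbitrary: s)
  case (Cons a q)
  show ?case
  proof (cases s)
    case (Cons b s')
    show ?thesis
    proof (cases "a = b")
      case True
      from Cons.IH[of s'] show ?thesis
      proof (elim disjE exE conjE)
        fix c i j w w' assume "q = c @ i # w" "s' = c @ j # w'" "i \<noteq> j"
        then have "a # q = (a # c) @ i # w \<and> s = (a # c) @ j # w' \<and> i \<noteq> j" using Cons True by simp
        then show ?thesis by blast
      qed (use Cons True in auto)
    next
      case False
      then have "a # q = [] @ a # q \<and> s = [] @ b # s' \<and> a \<noteq> b" using Cons by simp
      then show ?thesis by blast
    qed
  qed auto
qed auto

section \<open>From derivations to tree-cut decompositions\<close>

context cost_graph
begin

text \<open>The label of a position is meant to be the union of all bags at or below it, that is,
  one side of its parent edge.\<close>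

definition bag :: "nat list set \<Rightarrow> (nat list \<Rightarrow> 'v set) \<Rightarrow> nat list \<Rightarrow> 'v set" where
  "bag N lab p = lab p - \<Union>(lab ` kids N p)"

definition node_ok :: "nat list set \<Rightarrow> (nat list \<Rightarrow> 'v set) \<Rightarrow> nat list \<Rightarrow> bool" where
  "node_ok N lab p \<longleftrightarrow> (\<forall>q\<in>kids N p. lab q \<subseteq> lab p) \<and>
     (\<forall>q\<in>kids N p. \<forall>q'\<in>kids N p. q \<noteq> q' \<longrightarrow> lab q \<inter> lab q' = {}) \<and>
     card (bag N lab p) \<le> k \<and> card (bold_cuts (insert (lab p) (lab ` kids N p))) \<le> k"

lemma bold_cuts_insert_compl: "bold_cuts (insert (V - P) \<Pi>) = bold_cuts (insert P \<Pi>)"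
proof -
  have "bold_cuts (insert R \<Pi>) = (if 3 \<le> card (edge_cut G R) then edge_cut G R else {}) \<union> bold_cuts \<Pi>" for R
    unfolding bold_cuts_def by auto
  then show ?thesis by (simp add: cut_compl)
qed

text \<open>The branches of a node are numbered, and the positions of each branch are prefixed with
  its number. With no open leaves allowed, the leaf case is void.\<close>

lemma derivable_imp_positions:
  assumes "derivable {} P"
  shows "\<exists>N lab. positions N \<and> lab [] = P \<and> (\<forall>p\<in>N. node_ok N lab p)"
  using assms
proof (induction rule: derivable.induct)
  case (leaf P)
  then show ?case by simp
next
  case (node P X \<Pi>)
  have "\<Pi> \<subseteq> Pow V" using node.hyps(1,2) by auto
  then have "finite \<Pi>" using finite_V by (auto intro: finite_subset)
  then obtain h where h: "bij_betw h {0..<card \<Pi>} \<Pi>" using ex_bij_betw_nat_finite by blast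
  define m where "m = card \<Pi>"
  have hP: "h i \<in> \<Pi>" if "i < m" for i using h that unfolding m_def bij_betw_def by auto
  have himg: "h ` {..<m} = \<Pi>" using h unfolding m_def bij_betw_def by (simp add: lessThan_atLeast0)
  have hinj: "h i \<noteq> h j" if "i < m" "j < m" "i \<noteq> j" for i j
    using h that unfolding m_def bij_betw_def inj_on_def by auto
  have "\<forall>Q. \<exists>Nl. Q \<in> \<Pi> \<longrightarrow> positions (fst Nl) \<and> snd Nl [] = Q \<and> (\<forall>p\<in>fst Nl. node_ok (fst Nl) (snd Nl) p)"
    using node.IH by auto
  from choice[OF this] obtain Nl where Nl: "\<forall>Q. Q \<in> \<Pi> \<longrightarrow> positions (fst (Nl Q)) \<and> snd (Nl Q) [] = Q \<and>
      (\<forall>p\<in>fst (Nl Q). node_ok (fst (Nl Q)) (snd (Nl Q)) p)" by (elim exE)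
  define M where "M i = fst (Nl (h i))" for i
  define L where "L i = snd (Nl (h i))" for i
  have M: "positions (M i)" "L i [] = h i" "\<And>p. p \<in> M i \<Longrightarrow> node_ok (M i) (L i) p" if "i < m" for i
    using Nl hP[OF that] unfolding M_def L_def by auto
  define N where "N = insert [] (\<Union>i<m. (#) i ` M i)"
  define lab where "lab p = (case p of [] \<Rightarrow> P | i # p' \<Rightarrow> L i p')" for p
  have lab: "lab [] = P" "lab (i # p) = L i p" for i p by (simp_all add: lab_def)
  have N_Cons: "i # p \<in> N \<longleftrightarrow> i < m \<and> p \<in> M i" for i p unfolding N_def by auto
  have Nil_M: "[] \<in> M i" if "i < m" for i using M(1)[OF that] by (simp add: positions_def)
  have "positions N"
  proof
    show "finite N" using M(1) unfolding N_def by (auto simp: positions_def)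
    show "[] \<in> N" by (simp add: N_def)
    fix p i assume pi: "p @ [i] \<in> N"
    show "p \<in> N"
    proof (cases p)
      case (Cons j p')
      then have "j < m" "p' @ [i] \<in> M j" using pi N_Cons[of j "p' @ [i]"] by auto
      then show ?thesis using M(1)[of j] N_Cons Cons unfolding positions_def by auto
    qed (simp add: N_def)
  qed
  moreover have "node_ok N lab p" if p: "p \<in> N" for p
  proof (cases p)
    case Nil
    have kids: "kids N [] = (\<lambda>i. [i]) ` {..<m}"
      unfolding kids_def using N_Cons Nil_M by auto
    have img: "lab ` kids N [] = \<Pi>" unfolding kids image_image using himg M(2) by (auto simp: lab)
    have "bag N lab [] = X" unfolding bag_def img lab(1) using node.hyps(2,3) by auto
    moreover have "\<forall>q\<in>kids N []. lab q \<subseteq> P" using img node.hyps(2) by auto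
    moreover have "lab q \<inter> lab q' = {}" if qq: "q \<in> kids N []" "q' \<in> kids N []" "q \<noteq> q'" for q q'
    proof -
      obtain i j where ij: "q = [i]" "q' = [j]" "i < m" "j < m" "i \<noteq> j" using qq kids by auto
      then have "h i \<inter> h j = {}" using pdisjointD[OF node.hyps(4)] hP hinj by auto
      then show ?thesis using ij M(2) by (simp add: lab)
    qed
    moreover have "card (bold_cuts (insert P \<Pi>)) \<le> k" using node.hyps(6) bold_cuts_insert_compl by simp
    ultimately show ?thesis unfolding Nil node_ok_def img lab(1) using node.hyps(5) by auto
  next
    case (Cons i p')
    then have i: "i < m" "p' \<in> M i" using p N_Cons by auto
    have kids: "kids N p = (#) i ` kids (M i) p'"
      unfolding kids_def Cons using N_Cons i by auto
    have "lab ` kids N p = L i ` kids (M i) p'" unfolding kids image_image lab(2) ..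
    moreover have "lab p = L i p'" unfolding Cons lab(2) ..
    ultimately show ?thesis using M(3)[OF i] unfolding node_ok_def bag_def kids
      by (auto simp: lab(2))
  qed
  ultimately show ?case using lab(1) by blast
qed

lemma positions_imp_decomposition:
  assumes "positions N" and root: "lab [] = V" and ok: "\<And>p. p \<in> N \<Longrightarrow> node_ok N lab p"
  shows "\<exists>(T :: (nat, nat) mgraph) X. tree_cut_decomposition G T X \<and>
        adhesion_width G T X \<le> k \<and> bag_width T X \<le> k"
proof -
  interpret positions N by fact
  define X where "X a = bag N lab (list_decode a)" for a
  have X: "X (list_encode p) = bag N lab p" for p by (simp add: X_def)
  have kid: "lab (p @ [i]) \<subseteq> lab p" if "p @ [i] \<in> N" for p i
    using that ok[OF prefix_closed[OF that]] unfolding node_ok_def kids_def by auto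
  have kid_disj: "lab (p @ [i]) \<inter> lab (p @ [j]) = {}" if "p @ [i] \<in> N" "p @ [j] \<in> N" "i \<noteq> j" for p i j
    using that ok[OF prefix_closed[OF that(1)]] unfolding node_ok_def kids_def by auto
  have mono: "lab (p @ w) \<subseteq> lab p" if "p @ w \<in> N" for p w
    using that
  proof (induction w rule: rev_induct)
    case (snoc i w)
    have "(p @ w) @ [i] \<in> N" using snoc.prems by simp
    then show ?case using kid[of "p @ w" i] snoc.IH prefix_closed[of "p @ w" i] by auto
  qed simp
  \<comment> \<open>If \<open>s\<close> is not below \<open>q\<close>, then \<open>q\<close> lies
    below a child of \<open>s\<close>, whose label the bag excludes, or the two branch off at
    disjointly labelled siblings.\<close>
  have bag_lab: "x \<in> lab q \<longleftrightarrow> (\<exists>w. s = q @ w)" if "s \<in> N" "q \<in> N" "x \<in> bag N lab s" for x s q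
  proof
    assume "\<exists>w. s = q @ w"
    then show "x \<in> lab q" using mono[of q] that unfolding bag_def by auto
  next
    assume x: "x \<in> lab q"
    have xs: "x \<in> lab s" using that(3) unfolding bag_def by auto
    from list_compare[of s q] show "\<exists>w. s = q @ w"
    proof (elim disjE exE conjE)
      fix i w assume q: "q = s @ i # w"
      have "s @ [i] \<in> N" using prefix_closed_append[of "s @ [i]" w] q that(2) by simp
      moreover have "x \<in> lab (s @ [i])" using mono[of "s @ [i]" w] q that(2) x by auto
      ultimately show ?thesis using that(3) unfolding bag_def kids_def by auto
    next
      fix c i j w w' assume qs: "q = c @ i # w" "s = c @ j # w'" "i \<noteq> j"
      have "c @ [i] \<in> N" "c @ [j] \<in> N"
        using prefix_closed_append[of "c @ [i]" w] prefix_closed_append[of "c @ [j]" w'] qs that by auto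
      moreover have "x \<in> lab (c @ [i])" "x \<in> lab (c @ [j])"
        using mono[of "c @ [i]" w] mono[of "c @ [j]" w'] qs that x xs by auto
      ultimately show ?thesis using kid_disj qs(3) by blast
    qed auto
  qed
  \<comment> \<open>The bag is found at a deepest position whose label contains
    \<open>x\<close>.\<close>
  have bag_ex: "\<exists>s\<in>N. x \<in> bag N lab s" if x: "x \<in> V" for x
  proof -
    define D where "D = {s \<in> N. x \<in> lab s}"
    have "finite D" "D \<noteq> {}" using finite_N Nil_N root x unfolding D_def by auto
    then have "Max (length ` D) \<in> length ` D" by (intro Max_in) auto
    then obtain s where s: "s \<in> D" "length s = Max (length ` D)" by auto
    have "x \<notin> lab q" if "q \<in> kids N s" for q
    proof
      assume "x \<in> lab q"
      then have "q \<in> D" using that unfolding D_def kids_def by auto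
      then have "length q \<le> length s" unfolding s(2) using \<open>finite D\<close> by (intro Max_ge) auto
      then show False using that unfolding kids_def by auto
    qed
    then show ?thesis using s(1) unfolding D_def bag_def by auto
  qed
  have labV: "lab p \<subseteq> V" if "p \<in> N" for p using mono[of "[]" p] that root by auto
  have np: "near_partition (verts T) X V"
    unfolding near_partition_def
  proof (intro conjI ballI impI)
    fix a b assume "a \<in> verts T" "b \<in> verts T" "a \<noteq> b"
    then obtain p q where pq: "a = list_encode p" "b = list_encode q" "p \<in> N" "q \<in> N" "p \<noteq> q"
      by (auto simp: verts_T)
    show "X a \<inter> X b = {}"
    proof (rule ccontr)
      assume "X a \<inter> X b \<noteq> {}"
      then obtain x where x: "x \<in> bag N lab p" "x \<in> bag N lab q" using pq X by auto
      then have "x \<in> lab p" "x \<in> lab q" unfolding bag_def by auto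
      then obtain w w' where "p = q @ w" "q = p @ w'" using bag_lab pq x by metis
      then show False using pq(5) by auto
    qed
  next
    show "(\<Union>a\<in>verts T. X a) = V"
    proof (intro equalityI subsetI)
      fix x assume "x \<in> (\<Union>a\<in>verts T. X a)"
      then show "x \<in> V" using labV X unfolding verts_T bag_def by auto
    next
      fix x assume "x \<in> V"
      then show "x \<in> (\<Union>a\<in>verts T. X a)" using bag_ex[of x] X unfolding verts_T by auto
    qed
  qed
  have adh: "edge_adh G T X (list_encode q) = edge_cut G (lab q)" if q: "q \<in> N" "q \<noteq> []" for q
  proof (intro equalityI subsetI)
    fix e assume "e \<in> edge_adh G T X (list_encode q)"
    then obtain x y s t where e: "e \<in> E" "ends G e = {x, y}" "s \<in> N" "t \<in> N" "x \<in> bag N lab s" "y \<in> bag N lab t"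
      "\<not> reachable_avoiding T {list_encode q} (list_encode s) (list_encode t)"
      unfolding edge_adh_def verts_T by (auto simp: X)
    then have "(x \<in> lab q) \<noteq> (y \<in> lab q)"
      using T_reachable_iff[OF e(3,4) q] bag_lab[OF e(3) q(1) e(5)] bag_lab[OF e(4) q(1) e(6)] by auto
    then show "e \<in> edge_cut G (lab q)" using cut_pair_iff[OF e(1,2)] by auto
  next
    fix e assume "e \<in> edge_cut G (lab q)"
    then obtain x y where e: "e \<in> E" "ends G e = {x, y}" "x \<in> lab q" "y \<notin> lab q" "x \<in> V" "y \<in> V" by (elim cutE)
    obtain s where s: "s \<in> N" "x \<in> bag N lab s" using bag_ex[OF e(5)] by auto
    obtain t where t: "t \<in> N" "y \<in> bag N lab t" using bag_ex[OF e(6)] by auto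
    have "\<not> reachable_avoiding T {list_encode q} (list_encode s) (list_encode t)"
      using T_reachable_iff[OF s(1) t(1) q] bag_lab[OF s(1) q(1) s(2)] bag_lab[OF t(1) q(1) t(2)] e by auto
    then show "e \<in> edge_adh G T X (list_encode q)"
      unfolding edge_adh_def verts_T using e(1,2) s t X by blast
  qed
  have nadh: "card (node_adh G T X a) \<le> k" if a: "a \<in> verts T" for a
  proof -
    obtain p where p: "a = list_encode p" "p \<in> N" using a by (auto simp: verts_T)
    have "node_adh G T X a \<subseteq> bold_cuts (insert (lab p) (lab ` kids N p))"
    proof
      fix e assume "e \<in> node_adh G T X a"
      then obtain b where b: "b \<in> edges T" "a \<in> ends T b" "bold G T X b" "e \<in> edge_adh G T X b"
        unfolding node_adh_def by auto
      obtain q where q: "b = list_encode q" "q \<in> N" "q \<noteq> []" using b(1) by (auto simp: edges_T)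
      have "p = q \<or> p = butlast q" using b(2) p q by (auto simp: ends_T encode_eq)
      moreover have "q \<in> kids N p" if "p = butlast q"
        using that q append_butlast_last_id[OF q(3)] unfolding kids_def by (auto intro: exI[of _ "last q"])
      ultimately have "lab q \<in> insert (lab p) (lab ` kids N p)" by auto
      moreover have "3 \<le> card (edge_cut G (lab q))" "e \<in> edge_cut G (lab q)"
        using b(3,4) adh[OF q(2,3)] unfolding bold_def q(1) by auto
      ultimately show "e \<in> bold_cuts (insert (lab p) (lab ` kids N p))" unfolding bold_cuts_def by auto
    qed
    then have "card (node_adh G T X a) \<le> card (bold_cuts (insert (lab p) (lab ` kids N p)))"
      by (rule card_mono[OF finite_bold_cuts])
    then show ?thesis using ok[OF p(2)] unfolding node_ok_def by simp
  qed
  have bags: "card (X a) \<le> k" if "a \<in> verts T" for a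
    using that ok X unfolding verts_T node_ok_def by auto
  have fin: "finite (verts T)" "verts T \<noteq> {}" using finite_N Nil_N by (auto simp: verts_T)
  have "adhesion_width G T X \<le> k" "bag_width T X \<le> k"
    unfolding adhesion_width_def bag_width_def using fin nadh bags by (auto simp: Max_le_iff)
  moreover have "tree_cut_decomposition G T X"
    unfolding tree_cut_decomposition_def using T_is_tree np by simp
  ultimately show ?thesis by blast
qed

lemma derivable_imp_decomposition:
  assumes "derivable {} V"
  shows "\<exists>(T :: (nat, nat) mgraph) X. tree_cut_decomposition G T X \<and>
        adhesion_width G T X \<le> k \<and> bag_width T X \<le> k"
proof -
  obtain N lab where "positions N" "lab [] = V" "\<forall>p\<in>N. node_ok N lab p"
    using derivable_imp_positions[OF assms] by (elim exE conjE)
  then show ?thesis by (intro positions_imp_decomposition[of N lab]) auto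
qed

end

section \<open>Separation by an edge of an arbitrary tree\<close>

lemma path_between_distinct_edges:
  assumes "path_between G x vs es y"
  shows "distinct es"
proof -
  have p: "length vs = Suc (length es)" "distinct vs"
    "\<And>i. i < length es \<Longrightarrow> ends G (es ! i) = {vs ! i, vs ! Suc i}"
    using assms unfolding path_between_def by auto
  have "es ! i \<noteq> es ! j" if ij: "i < length es" "j < length es" "i \<noteq> j" for i j
  proof
    assume "es ! i = es ! j"
    then have "{vs ! i, vs ! Suc i} = {vs ! j, vs ! Suc j}" using p(3)[of i] p(3)[of j] ij by auto
    then have "(vs ! i = vs ! j \<and> vs ! Suc i = vs ! Suc j) \<or> (vs ! i = vs ! Suc j \<and> vs ! Suc i = vs ! j)"
      by (auto simp: doubleton_eq_iff)
    then show False using ij p(1) nth_eq_iff_index_eq[OF p(2)] by auto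
  qed
  then show ?thesis by (simp add: distinct_conv_nth)
qed

locale tree =
  fixes T :: "('n, 'm) mgraph"
  assumes tree: "is_tree T"
begin

lemma tree_multigraph: "multigraph T" and tree_nonempty: "verts T \<noteq> {}"
  and tree_connected: "\<And>s t. s \<in> verts T \<Longrightarrow> t \<in> verts T \<Longrightarrow> reachable_avoiding T {} s t"
  and tree_acyclic: "\<And>vs es. \<not> is_cycle T vs es"
  using tree unfolding is_tree_def by auto

text \<open>A path avoiding \<open>a\<close> between its ends would close up with \<open>a\<close>
  to a cycle, possibly just a pair of parallel edges.\<close>

lemma tree_edge_separates:
  assumes "a \<in> edges T" "ends T a = {t, t'}"
  shows "(t, t') \<notin> (adj T {a})\<^sup>*"
proof
  assume r: "(t, t') \<in> (adj T {a})\<^sup>*"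
  have a: "ends T a \<subseteq> verts T" "card (ends T a) = 2"
    using tree_multigraph assms(1) unfolding multigraph_def by auto
  have tt: "t \<noteq> t'" "t' \<in> verts T" using a assms(2) by (auto simp: card_insert_if split: if_splits)
  from rtrancl_adj_imp_path[OF tree_multigraph r tt(2)]
  obtain vs es where p: "path_between T t vs es t'" "a \<notin> set es" by auto
  have q: "length vs = Suc (length es)" "hd vs = t" "last vs = t'" "set vs \<subseteq> verts T"
    "set es \<subseteq> edges T" "distinct vs" "\<And>i. i < length es \<Longrightarrow> ends T (es ! i) = {vs ! i, vs ! Suc i}"
    using p(1) unfolding path_between_def by auto
  have ne: "vs \<noteq> []" using q(1) by auto
  have "es \<noteq> []"
  proof
    assume "es = []"
    then obtain v where "vs = [v]" using q(1) by (cases vs) auto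
    then show False using q(2,3) tt(1) by simp
  qed
  have ends: "ends T ((es @ [a]) ! i) = {vs ! i, vs ! (Suc i mod length vs)}" if "i < length (es @ [a])" for i
  proof (cases "i < length es")
    case True
    then show ?thesis using q(1,7) by (simp add: nth_append)
  next
    case False
    then have "i = length es" using that by simp
    moreover have "vs ! length es = t'" "vs ! 0 = t" using q(1,2,3) ne by (auto simp: hd_conv_nth last_conv_nth)
    ultimately show ?thesis using assms(2) q(1) by (simp add: insert_commute)
  qed
  have "is_cycle T vs (es @ [a])"
    unfolding is_cycle_def
    using q ends path_between_distinct_edges[OF p(1)] p(2) assms(1) \<open>es \<noteq> []\<close>
    by (cases es) auto
  then show False using tree_acyclic by blast
qed

lemma tree_edge_sides:
  assumes "a \<in> edges T" "ends T a = {t, t'}" "s \<in> verts T"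
  shows "(t, s) \<in> (adj T {a})\<^sup>* \<or> (t', s) \<in> (adj T {a})\<^sup>*"
proof -
  have "t \<in> verts T" using tree_multigraph assms unfolding multigraph_def by blast
  then have r: "(t, s) \<in> (adj T {})\<^sup>*"
    using tree_connected[of t s] assms(3) reachable_iff[OF tree_multigraph] by auto
  let ?Z = "{s. (t, s) \<in> (adj T {a})\<^sup>* \<or> (t', s) \<in> (adj T {a})\<^sup>*}"
  have "s \<in> ?Z"
  proof (rule rtrancl_adj_closed[OF r])
    fix e p q assume e: "e \<in> edges T - {}" "ends T e = {p, q}" and p: "p \<in> ?Z"
    show "q \<in> ?Z"
    proof (cases "e = a")
      case True
      then have "q = t \<or> q = t'" using e assms(2) by (auto simp: doubleton_eq_iff)
      then show ?thesis by auto
    next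
      case False
      then have "(p, q) \<in> adj T {a}" using e unfolding adj_def by auto
      then show ?thesis using p by (auto intro: rtrancl_into_rtrancl)
    qed
  qed simp
  then show ?thesis by simp
qed

lemma tree_first_edge:
  assumes "t \<in> verts T" "s \<in> verts T" "s \<noteq> t"
  shows "\<exists>a t'. a \<in> edges T \<and> ends T a = {t, t'} \<and> (t', s) \<in> (adj T {a})\<^sup>*"
proof -
  obtain vs es where p: "path_between T t vs es s"
    using tree_connected[OF assms(1,2)] unfolding reachable_avoiding_def by auto
  have q: "length vs = Suc (length es)" "hd vs = t" "last vs = s"
    "set es \<subseteq> edges T" "distinct vs" "\<And>i. i < length es \<Longrightarrow> ends T (es ! i) = {vs ! i, vs ! Suc i}"
    using p unfolding path_between_def by auto
  have ne: "vs \<noteq> []" using q(1) by auto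
  have "es \<noteq> []"
  proof
    assume "es = []"
    then obtain v where "vs = [v]" using q(1) by (cases vs) auto
    then show False using q(2,3) assms(3) by simp
  qed
  then have len: "0 < length es" by simp
  have v0: "vs ! 0 = t" using q(2) ne by (simp add: hd_conv_nth)
  have e0: "ends T (es ! 0) = {t, vs ! 1}" "es ! 0 \<in> edges T"
    using q(6)[OF len] v0 q(4) len by (auto intro: nth_mem)
  have d: "path_between T (vs ! 1) (drop 1 vs) (drop 1 es) s"
    using path_between_drop[OF p, of 1] q(1) len by simp
  have "es ! 0 \<notin> set (drop 1 es)"
    using path_between_distinct_edges[OF p] len
    by (metis Cons_nth_drop_Suc One_nat_def distinct.simps(2) drop0)
  then have "(vs ! 1, s) \<in> (adj T {es ! 0})\<^sup>*" using path_imp_rtrancl_adj[OF d] by auto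
  then show ?thesis using e0 by auto
qed

text \<open>This yields the termination measure of the search: \<open>t'\<close> drops out of the
  side when the cops move on from it.\<close>

lemma tree_sides_nested:
  assumes a: "a \<in> edges T" "ends T a = {t, t'}" and b: "b \<in> edges T" "ends T b = {t', t''}" and ne: "a \<noteq> b"
  shows "{s. (t'', s) \<in> (adj T {b})\<^sup>*} \<subset> {s. (t', s) \<in> (adj T {a})\<^sup>*}"
proof -
  have sep: "(t'', t') \<notin> (adj T {b})\<^sup>*" using tree_edge_separates[OF b(1)] b(2) by (simp add: insert_commute)
  have b': "(t', t'') \<in> adj T {a}" using b ne unfolding adj_def by auto
  have "(t', s) \<in> (adj T {a})\<^sup>*" if "(t'', s) \<in> (adj T {b})\<^sup>*" for s
    using that
  proof (induction rule: rtrancl_induct)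
    case base
    then show ?case using b' by auto
  next
    case (step y z)
    then obtain e where e: "e \<in> edges T" "e \<noteq> b" "ends T e = {y, z}" unfolding adj_def by auto
    have "e \<noteq> a"
    proof
      assume "e = a"
      then have "y = t' \<or> z = t'" using a(2) e(3) by (auto simp: doubleton_eq_iff)
      then show False using step.hyps sep by (auto intro: rtrancl_into_rtrancl)
    qed
    then have "(y, z) \<in> adj T {a}" using e unfolding adj_def by auto
    then show ?case using step.IH by (auto intro: rtrancl_into_rtrancl)
  qed
  then show ?thesis using sep by auto
qed

end

subsection \<open>The search strategy of the cops\<close>

locale decomposition = fin_graph G + tree T
  for G :: "('v, 'e) mgraph" and T :: "('n, 'm) mgraph" +
  fixes X :: "'n \<Rightarrow> 'v set" and k :: nat
  assumes bags: "near_partition (verts T) X (verts G)"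
    and adh_le: "t \<in> verts T \<Longrightarrow> card (node_adh G T X t) \<le> k"
    and bag_le: "t \<in> verts T \<Longrightarrow> card (X t) \<le> k"
begin

definition home :: "'v \<Rightarrow> 'n" where
  "home x = (SOME t. t \<in> verts T \<and> x \<in> X t)"

lemma home: "x \<in> V \<Longrightarrow> home x \<in> verts T" "x \<in> V \<Longrightarrow> x \<in> X (home x)"
proof -
  assume "x \<in> V"
  then have "\<exists>t. t \<in> verts T \<and> x \<in> X t" using bags unfolding near_partition_def by auto
  from someI_ex[OF this] show "home x \<in> verts T" "x \<in> X (home x)" unfolding home_def by auto
qed

lemma home_unique: "t \<in> verts T \<Longrightarrow> x \<in> X t \<Longrightarrow> home x = t"
proof -
  assume t: "t \<in> verts T" "x \<in> X t"
  then have x: "x \<in> V" using bags unfolding near_partition_def by auto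
  show "home x = t"
  proof (rule ccontr)
    assume "home x \<noteq> t"
    then have "X (home x) \<inter> X t = {}" using bags home(1)[OF x] t(1) unfolding near_partition_def by auto
    then show False using home(2)[OF x] t(2) by auto
  qed
qed

lemma edge_adh_eq_cut:
  assumes "a \<in> edges T" "ends T a = {t, t'}"
  shows "edge_adh G T X a = edge_cut G {x \<in> V. (t', home x) \<in> (adj T {a})\<^sup>*}" (is "_ = edge_cut G ?Z")
proof -
  let ?R = "(adj T {a})\<^sup>*"
  have iff: "reachable_avoiding T {a} (home x) (home y) \<longleftrightarrow> (x \<in> ?Z \<longleftrightarrow> y \<in> ?Z)" if xy: "x \<in> V" "y \<in> V" for x y
  proof -
    have "(home x, home y) \<in> ?R \<longleftrightarrow> ((t', home x) \<in> ?R \<longleftrightarrow> (t', home y) \<in> ?R)"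
    proof
      assume r: "(home x, home y) \<in> ?R"
      show "(t', home x) \<in> ?R \<longleftrightarrow> (t', home y) \<in> ?R"
        using rtrancl_trans[OF _ r] rtrancl_trans[OF _ adj_rtrancl_sym[OF r]] by auto
    next
      assume iff: "(t', home x) \<in> ?R \<longleftrightarrow> (t', home y) \<in> ?R"
      obtain c where "(c, home x) \<in> ?R" "(c, home y) \<in> ?R"
        using iff tree_edge_sides[OF assms home(1)[OF xy(1)]] tree_edge_sides[OF assms home(1)[OF xy(2)]] by auto
      then show "(home x, home y) \<in> ?R" using rtrancl_trans[OF adj_rtrancl_sym] by metis
    qed
    then show ?thesis using reachable_iff[OF tree_multigraph] home(1)[OF xy(2)] xy by auto
  qed
  show ?thesis
  proof (intro equalityI subsetI)
    fix e assume "e \<in> edge_adh G T X a"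
    then obtain x y s r where e: "e \<in> E" "ends G e = {x, y}" "s \<in> verts T" "r \<in> verts T" "x \<in> X s" "y \<in> X r"
      "\<not> reachable_avoiding T {a} s r" unfolding edge_adh_def by auto
    have "x \<in> V" "y \<in> V" using ends_subset[OF e(1)] e(2) by auto
    then show "e \<in> edge_cut G ?Z"
      using iff[of x y] e(7) home_unique[OF e(3,5)] home_unique[OF e(4,6)] cut_pair_iff[OF e(1,2)] by auto
  next
    fix e assume "e \<in> edge_cut G ?Z"
    then obtain x y where e: "e \<in> E" "ends G e = {x, y}" "x \<in> ?Z" "y \<notin> ?Z" "x \<in> V" "y \<in> V" by (elim cutE)
    have "\<not> reachable_avoiding T {a} (home x) (home y)" using iff[OF e(5,6)] e(3,4) by blast
    then show "e \<in> edge_adh G T X a"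
      unfolding edge_adh_def using e(1,2) home[OF e(5)] home[OF e(6)] by blast
  qed
qed

text \<open>Used twice: for a robber move, with \<open>F\<close> the edges occupied both before and
  after it, and for capture, with \<open>F\<close> the current cop position.\<close>

lemma side_invariant:
  assumes a: "a \<in> edges T" "ends T a = {t, t'}"
    and xy: "x \<in> V" "y \<in> V" "three_edge_connected G x y" "reachable_avoiding G F x y"
    and F: "bold G T X a \<Longrightarrow> edge_adh G T X a \<subseteq> F"
  shows "(t', home x) \<in> (adj T {a})\<^sup>* \<longleftrightarrow> (t', home y) \<in> (adj T {a})\<^sup>*"
proof -
  define Z where "Z = {x \<in> V. (t', home x) \<in> (adj T {a})\<^sup>*}"
  have adh: "edge_adh G T X a = edge_cut G Z" using edge_adh_eq_cut[OF a] unfolding Z_def .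
  have "x \<in> Z \<longleftrightarrow> y \<in> Z"
  proof (cases "bold G T X a")
    case True
    then have "edge_cut G Z \<subseteq> F" using F adh by simp
    obtain vs es where p: "path_between G x vs es y" "set es \<inter> F = {}"
      using xy(4) unfolding reachable_avoiding_def by auto
    then show ?thesis using path_meets_cut[OF p(1), of Z] \<open>edge_cut G Z \<subseteq> F\<close> by blast
  next
    case False
    then have "card (edge_cut G Z) \<le> 2" unfolding bold_def adh by simp
    then show ?thesis using three_edge_connected_imp_same_class[OF xy(3)] unfolding same_class_def by blast
  qed
  then show ?thesis using xy(1,2) unfolding Z_def by simp
qed

text \<open>To leave the bag she would have to cross a tree edge at the node, and each of these is
  guarded or thin; so her territory has at most \<open>k\<close> vertices.\<close>

lemma caught_at_home:
  assumes x: "x \<in> V"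
  shows "caught G k (node_adh G T X (home x)) x"
proof -
  let ?t = "home x"
  have "{y \<in> V. three_edge_connected G x y \<and> reachable_avoiding G (node_adh G T X ?t) x y} \<subseteq> X ?t"
  proof
    fix y assume "y \<in> {y \<in> V. three_edge_connected G x y \<and> reachable_avoiding G (node_adh G T X ?t) x y}"
    then have y: "y \<in> V" "three_edge_connected G x y" "reachable_avoiding G (node_adh G T X ?t) x y" by auto
    have "home y = ?t"
    proof (rule ccontr)
      assume "home y \<noteq> ?t"
      then obtain a t' where a: "a \<in> edges T" "ends T a = {?t, t'}" "(t', home y) \<in> (adj T {a})\<^sup>*"
        using tree_first_edge[OF home(1)[OF x] home(1)[OF y(1)]] by auto
      have "edge_adh G T X a \<subseteq> node_adh G T X ?t" if "bold G T X a"
        using that a unfolding node_adh_def by auto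
      then have "(t', ?t) \<in> (adj T {a})\<^sup>*" using side_invariant[OF a(1,2) x y] a(3) by auto
      moreover have "ends T a = {t', ?t}" using a(2) by auto
      ultimately show False using tree_edge_separates[OF a(1)] by auto
    qed
    then show "y \<in> X ?t" using home(2)[OF y(1)] by simp
  qed
  moreover have "finite (X ?t)"
    using finite_V home(1)[OF x] bags unfolding near_partition_def by (auto intro: finite_subset)
  ultimately show ?thesis
    unfolding caught_def using card_mono bag_le[OF home(1)[OF x]] by (meson le_trans)
qed

definition towards :: "'n \<Rightarrow> 'v \<Rightarrow> 'm \<times> 'n" where
  "towards t x = (SOME p. fst p \<in> edges T \<and> ends T (fst p) = {t, snd p} \<and>
     (snd p, home x) \<in> (adj T {fst p})\<^sup>*)"

lemma towards:
  assumes "t \<in> verts T" "x \<in> V" "home x \<noteq> t"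
  shows "fst (towards t x) \<in> edges T" "ends T (fst (towards t x)) = {t, snd (towards t x)}"
    "(snd (towards t x), home x) \<in> (adj T {fst (towards t x)})\<^sup>*"
proof -
  have "\<exists>p. fst p \<in> edges T \<and> ends T (fst p) = {t, snd p} \<and> (snd p, home x) \<in> (adj T {fst p})\<^sup>*"
    using tree_first_edge[OF assms(1) home(1)[OF assms(2)] assms(3)] by auto
  from someI_ex[OF this] show "fst (towards t x) \<in> edges T" "ends T (fst (towards t x)) = {t, snd (towards t x)}"
    "(snd (towards t x), home x) \<in> (adj T {fst (towards t x)})\<^sup>*"
    unfolding towards_def by auto
qed

text \<open>The default \<open>t\<close> is never taken in a play without capture; it is there
  because a valid strategy must answer every list.\<close>

definition advance :: "'n \<Rightarrow> 'v \<Rightarrow> 'n" where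
  "advance t x = (if x \<in> V \<and> home x \<noteq> t then snd (towards t x) else t)"

lemma advance_verts: "t \<in> verts T \<Longrightarrow> advance t x \<in> verts T"
  using towards(1,2)[of t x] tree_multigraph unfolding advance_def multigraph_def by fastforce

lemma foldl_advance_verts: "t \<in> verts T \<Longrightarrow> foldl advance t xs \<in> verts T"
  by (induction xs arbitrary: t) (auto intro: advance_verts)

theorem searchable: "searchable G k k"
proof -
  obtain t0 where t0: "t0 \<in> verts T" using tree_nonempty by auto
  \<comment> \<open>\<open>r 0\<close> is discarded: no edge is guarded before round 1, so the
    search starts at \<open>t0\<close> wherever she is. The value at \<open>[]\<close> is never
    announced, since round \<open>i\<close> sees a history of length
    \<open>i \<ge> 1\<close>.\<close>
  define \<sigma> where "\<sigma> h = (case h of [] \<Rightarrow> {} | x # xs \<Rightarrow> node_adh G T X (foldl advance t0 xs))" for h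
  have "node_adh G T X t \<subseteq> E" for t unfolding node_adh_def edge_adh_def by auto
  then have "valid_cop_strategy G k \<sigma>"
    unfolding valid_cop_strategy_def \<sigma>_def
    using adh_le[OF foldl_advance_verts[OF t0]] by (auto split: list.split)
  moreover have "\<exists>i\<ge>1. caught G k (cop_position \<sigma> r i) (r i)" if play: "robber_play G \<sigma> r" for r
  proof (rule ccontr)
    assume no: "\<not> ?thesis"
    define m where "m i = foldl advance t0 (map r [1..<Suc i])" for i
    have mV: "m i \<in> verts T" for i unfolding m_def by (rule foldl_advance_verts[OF t0])
    have m_Suc: "m (Suc i) = advance (m i) (r (Suc i))" for i unfolding m_def by simp
    have "map r [0..<Suc i] = r 0 # map r [1..<Suc i]" for i by (subst upt_conv_Cons) auto
    then have pos: "cop_position \<sigma> r (Suc i) = node_adh G T X (m i)" for i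
      unfolding cop_position_def \<sigma>_def m_def by simp
    have move: "r (Suc i) \<in> V" "reachable_avoiding G (cop_position \<sigma> r i \<inter> cop_position \<sigma> r (Suc i)) (r i) (r (Suc i))"
      "three_edge_connected G (r i) (r (Suc i))" for i
      using play unfolding robber_play_def robber_move_def by auto
    have away: "home (r (Suc i)) \<noteq> m i" for i
    proof
      assume "home (r (Suc i)) = m i"
      then have "caught G k (cop_position \<sigma> r (Suc i)) (r (Suc i))"
        using caught_at_home[OF move(1)[of i]] pos[of i] by simp
      then show False using no by auto
    qed
    define a where "a i = fst (towards (m i) (r (Suc i)))" for i
    have m': "m (Suc i) = snd (towards (m i) (r (Suc i)))" for i
      unfolding m_Suc advance_def using move(1) away by simp
    have a: "a i \<in> edges T" "ends T (a i) = {m i, m (Suc i)}" "(m (Suc i), home (r (Suc i))) \<in> (adj T {a i})\<^sup>*" for i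
      using towards[OF mV move(1) away, of i] unfolding a_def m' by auto
    define side where "side i = {s. (m (Suc i), s) \<in> (adj T {a i})\<^sup>*}" for i
    have stay: "home (r (Suc (Suc i))) \<in> side i" for i
    proof -
      have "edge_adh G T X (a i) \<subseteq> node_adh G T X (m i) \<inter> node_adh G T X (m (Suc i))" if "bold G T X (a i)"
        using that a(1,2)[of i] unfolding node_adh_def by auto
      then have "(m (Suc i), home (r (Suc i))) \<in> (adj T {a i})\<^sup>* \<longleftrightarrow> (m (Suc i), home (r (Suc (Suc i)))) \<in> (adj T {a i})\<^sup>*"
        using move(2)[of "Suc i"] unfolding pos
        by (intro side_invariant[OF a(1,2) move(1) move(1) move(3)]) auto
      then show ?thesis using a(3)[of i] unfolding side_def by simp
    qed
    have "side (Suc i) \<subset> side i" for i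
    proof -
      \<comment> \<open>Turning back along the same edge would mean that she had crossed it,
        contrary to \<open>stay\<close>.\<close>
      have "a i \<noteq> a (Suc i)"
      proof
        assume eq: "a i = a (Suc i)"
        have "{m i, m (Suc i)} = {m (Suc i), m (Suc (Suc i))}" using a(2)[of i] a(2)[of "Suc i"] eq by simp
        then have mm: "m (Suc (Suc i)) = m i" by (auto simp: doubleton_eq_iff)
        have "(m i, home (r (Suc (Suc i)))) \<in> (adj T {a i})\<^sup>*" using a(3)[of "Suc i"] eq mm by simp
        moreover have "(m (Suc i), home (r (Suc (Suc i)))) \<in> (adj T {a i})\<^sup>*" using stay[of i] unfolding side_def by simp
        ultimately have "(m i, m (Suc i)) \<in> (adj T {a i})\<^sup>*" using rtrancl_trans[OF _ adj_rtrancl_sym] by metis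
        then show False using tree_edge_separates[OF a(1,2)] by blast
      qed
      then show ?thesis using tree_sides_nested[OF a(1,2) a(1,2)] unfolding side_def by auto
    qed
    moreover have "side i \<subseteq> verts T" for i
    proof
      fix s assume "s \<in> side i"
      then have r: "(m (Suc i), s) \<in> (adj T {a i})\<^sup>*" unfolding side_def by simp
      show "s \<in> verts T"
        by (rule rtrancl_adj_closed[OF r mV]) (use tree_multigraph in \<open>auto simp: multigraph_def\<close>)
    qed
    then have "finite (side i)" for i
      using tree_multigraph unfolding multigraph_def by (meson finite_subset)
    ultimately have dec: "card (side (Suc i)) < card (side i)" for i by (meson psubset_card_mono)
    have "card (side i) + i \<le> card (side 0)" for i
    proof (induction i)
      case (Suc i)
      then show ?case using dec[of i] by simp
    qed simp
    from this[of "Suc (card (side 0))"] show False by simp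
  qed
  ultimately show ?thesis unfolding searchable_def by blast
qed

end

theorem corollary5p2:
  fixes G :: "('v, 'e) mgraph" and k :: nat
  assumes "multigraph G" and "verts G \<noteq> {}"
  shows "ab_tree_cut_width G \<le> k \<longleftrightarrow> k_searchable G k"
proof -
  define dec where "dec n \<longleftrightarrow> (\<exists>(T :: (nat, nat) mgraph) X. tree_cut_decomposition G T X \<and>
        adhesion_width G T X \<le> n \<and> bag_width T X \<le> n)" for n
  have width: "ab_tree_cut_width G = (LEAST n. dec n)"
    unfolding ab_tree_cut_width_def dec_def ..
  \<comment> \<open>Some admissible number must exist for \<open>LEAST\<close> to be attained: a
    single node with bag \<open>V\<close>, obtained by taking \<open>card (verts G)\<close> as the
    bound of the locale.\<close>
  have trivial_dec: "dec (card (verts G))"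
  proof -
    interpret cost_graph G "card (verts G)" using assms(1) by unfold_locales
    have "derivable {} V"
      by (rule derivable.node[of _ V "{}"]) (auto simp: pdisjoint_def bold_cuts_def cut_empty)
    then show ?thesis unfolding dec_def by (rule derivable_imp_decomposition)
  qed
  have "ab_tree_cut_width G \<le> k \<longleftrightarrow> dec k"
  proof
    assume "ab_tree_cut_width G \<le> k"
    moreover have "dec (ab_tree_cut_width G)" unfolding width using trivial_dec by (rule LeastI)
    ultimately show "dec k" unfolding dec_def by (meson le_trans)
  next
    assume "dec k"
    then show "ab_tree_cut_width G \<le> k" unfolding width by (rule Least_le)
  qed
  also have "dec k \<longleftrightarrow> k_searchable G k"
  proof
    assume "dec k"
    then obtain T :: "(nat, nat) mgraph" and X where T: "is_tree T" "near_partition (verts T) X (verts G)"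
      "adhesion_width G T X \<le> k" "bag_width T X \<le> k"
      unfolding dec_def tree_cut_decomposition_def by auto
    have fin: "finite (verts T)" using T(1) unfolding is_tree_def multigraph_def by auto
    have "card (node_adh G T X t) \<le> k" "card (X t) \<le> k" if "t \<in> verts T" for t
      using T(3,4) fin that unfolding adhesion_width_def bag_width_def
      by (meson Max_ge finite_imageI imageI le_trans)+
    then interpret decomposition G T X k using assms(1) T(1,2) by unfold_locales auto
    show "k_searchable G k" unfolding k_searchable_def by (rule searchable)
  next
    assume "k_searchable G k"
    interpret cost_graph G k using assms(1) by unfold_locales
    have "derivable {} V"
      using searchable_imp_derivable assms(2) \<open>k_searchable G k\<close> unfolding k_searchable_def by blast
    then show "dec k" unfolding dec_def by (rule derivable_imp_decomposition)
  qed
  finally show ?thesis .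
qed

end
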